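(* Assume the standing assumptions in the context, and let $f\in AC([T,x_0))$. The following are equivalent: (i) there are real numbers $a_1,a_2$ with $f(x)=a_1\phi_1(x)+a_2\phi_2(x)+o(\phi_2(x))$ as $x\to x_0$; (ii) the finite limit $$\lim_{x\to x_0}\frac{\phi_1(x)}{\phi_2(x)}\int_x^{x_0}W(t)\phi_1(t)^{-2}f_2^*(t)\,dt\equiv\lim_{x\to x_0}\frac{\phi_1(x)}{\phi_2(x)}\int_x^{x_0}\Big(\frac{\phi_2(t)}{\phi_1(t)}\Big)'f_2^*(t)\,dt=:-m$$ exists (the improper integrals being convergent); (iii) the finite limit $$\lim_{x\to x_0}\frac{\Phi(x)}{\phi_2(x)}\int_x^{x_0}W(t)\Phi(t)^{-2}F^*(t)\,dt=:-\frac{l}{\phi_2(T)}$$ exists (the improper integral being convergent). If this is the case then, with $a_1,a_2$ as in (i) and $m,l$ as in (ii),(iii), $$f(x)=a_1\phi_1(x)+a_2\phi_2(x)-\phi_1(x)\int_x^{x_0}\Big(\frac{\phi_2(t)}{\phi_1(t)}\Big)'[f_2^*(t)-m]\,dt,\qquad x\in[T,x_0),$$ $$f(x)=a_1\phi_1(x)+a_2\phi_2(x)-\Phi(x)\int_x^{x_0}W(t)\Phi(t)^{-2}[F^*(t)-l]\,dt,\qquad x\in(T,x_0).$$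
   Context: Let $x_0\in\mathbb{R}\cup\{+\infty\}$, $T\in\mathbb{R}$ with $T<x_0$, and $I:=[T,x_0)$. All limits and asymptotic relations "as $x\to x_0$" are taken for $x\in I$. For differentiable $g,h$ put $W(g,h;x):=g(x)h'(x)-g'(x)h(x)$. Standing assumptions: $\phi_1,\phi_2\in C^1(I)$; $\phi_2(x)=o(\phi_1(x))$ as $x\to x_0$; $\phi_1(x)\ne0$, $\phi_2(x)\neq0$ for all $x\in I$; $W(x):=W(\phi_1,\phi_2;x)\ne0$ for all $x\in I$. $AC([T,x_0))$ denotes functions absolutely continuous on every compact subinterval of $I$. For such $f$ and every $t\in I$ where $f$ is differentiable define $f_1^*(t):=W(f,\phi_2;t)/W(t)$, $f_2^*(t):=-W(f,\phi_1;t)/W(t)$; put $\Phi(x):=\phi_2(T)\phi_1(x)-\phi_1(T)\phi_2(x)$ and $F^*(t):=\phi_1(T)f_1^*(t)+\phi_2(T)f_2^*(t)=W(\Phi,f;t)/W(t)$. *)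

theory Defs
  imports "HOL-Analysis.Analysis" "HOL-Library.Landau_Symbols"
begin

definition abs_cont_on_interval :: "real \<Rightarrow> real \<Rightarrow> (real \<Rightarrow> real) \<Rightarrow> bool" where
  "abs_cont_on_interval a b f \<longleftrightarrow>
     (\<forall>\<epsilon>>0. \<exists>\<delta>>0. \<forall>(n::nat) (u::nat \<Rightarrow> real) (v::nat \<Rightarrow> real).
        (\<forall>i<n. a \<le> u i \<and> u i \<le> v i \<and> v i \<le> b) \<and>
        (\<forall>i<n. \<forall>j<n. i \<noteq> j \<longrightarrow> {u i<..<v i} \<inter> {u j<..<v j} = {}) \<and>
        (\<Sum>i<n. v i - u i) < \<delta>
        \<longrightarrow> (\<Sum>i<n. \<bar>f (v i) - f (u i)\<bar>) < \<epsilon>)"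

definition half_open :: "real \<Rightarrow> ereal \<Rightarrow> real set" where
  "half_open T x0 = {x. T \<le> x \<and> ereal x < x0}"

definition AC_on :: "real \<Rightarrow> ereal \<Rightarrow> (real \<Rightarrow> real) \<Rightarrow> bool" where
  "AC_on T x0 f \<longleftrightarrow> (\<forall>a b. T \<le> a \<and> a \<le> b \<and> ereal b < x0 \<longrightarrow> abs_cont_on_interval a b f)"

definition lim_filter :: "ereal \<Rightarrow> real filter" where
  "lim_filter x0 = (if x0 = \<infinity> then at_top else at_left (real_of_ereal x0))"

definition improper_conv :: "(real \<Rightarrow> real) \<Rightarrow> real \<Rightarrow> ereal \<Rightarrow> bool" where
  "improper_conv g x x0 \<longleftrightarrow>
     (\<forall>y. x \<le> y \<and> ereal y < x0 \<longrightarrow> g integrable_on {x..y}) \<and>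
     (\<exists>L. ((\<lambda>y. integral {x..y} g) \<longlongrightarrow> L) (lim_filter x0))"

definition improper_int :: "(real \<Rightarrow> real) \<Rightarrow> real \<Rightarrow> ereal \<Rightarrow> real" where
  "improper_int g x x0 = Lim (lim_filter x0) (\<lambda>y. integral {x..y} g)"

text \<open>Wronskian W(g,h;t) = g(t) h'(t) - g'(t) h(t), with the derivatives given as dg, dh.\<close>
definition Wr :: "(real \<Rightarrow> real) \<Rightarrow> (real \<Rightarrow> real) \<Rightarrow> (real \<Rightarrow> real) \<Rightarrow> (real \<Rightarrow> real) \<Rightarrow> real \<Rightarrow> real" where
  "Wr g dg h dh t = g t * dh t - dg t * h t"

end

theory Submission
  imports Defs
begin

text \<open>
  Put \<open>h = f/\<phi>1\<close>. The kernel \<open>W \<phi>1\<^sup>-\<^sup>2 f\<^sub>2\<^sup>*\<close> is the almost everywhere derivative of the locally absolutely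
  continuous function \<open>h\<close>, so its integral over \<open>[x, x0)\<close> is \<open>lim h - h x\<close>, and (i) says precisely that
  \<open>h\<close> has a limit \<open>a1\<close> with \<open>\<phi>1/\<phi>2 (a1 - h)\<close> tending to \<open>-a2\<close>; hence \<open>m = a2\<close>. Since
  \<open>W \<phi>1\<^sup>-\<^sup>2 = (\<phi>2/\<phi>1)'\<close>, subtracting \<open>m\<close> gives the representation formula. Statement (iii) is the same assertion
  for the pair \<open>(\<Phi>, \<phi>2)\<close>, whose Wronskian is \<open>\<phi>2(T) W\<close>; \<open>\<Phi>\<close> has no zero in \<open>(T, x0)\<close> because \<open>\<phi>2/\<phi>1\<close> has a
  nonvanishing derivative.

  The fundamental theorem of calculus for absolutely continuous functions is obtained directly for the
  Henstock-Kurzweil integral. Almost everywhere differentiability follows Austin: in a division of almost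
  maximal variation, Vitali selects small intervals on which the slope opposes the increment of the
  surrounding cell; refining by them would increase the variation by a fixed amount.
\<close>

section \<open>The fundamental theorem of calculus for absolutely continuous functions\<close>

hide_const (open) Polynomial.content

text \<open>Written with \<open>Sup\<close> and \<open>Inf\<close> so that it depends on the cell as
  a set, as sums over divisions require. The value 0 on the empty set matches the additive interval
  function of the library.\<close>

definition increment :: "(real \<Rightarrow> real) \<Rightarrow> real set \<Rightarrow> real" where
  "increment f K = (if K = {} then 0 else f (Sup K) - f (Inf K))"

lemma increment_Icc [simp]: "a \<le> b \<Longrightarrow> increment f {a..b} = f b - f a"
  by (simp add: increment_def)

text \<open>The increments telescope. They form an additive interval function, so the library's
  result on operative interval functions collapses the sum over any division.\<close>

lemma sum_increment_division:
  assumes "D division_of {a..b}" "a \<le> b"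
  shows "(\<Sum>K\<in>D. increment f K) = f b - f a"
proof -
  let ?f = "\<lambda>K::real set. if K = {} then 0 else f (interval_upperbound K) - f (interval_lowerbound K)"
  interpret operative_real plus 0 ?f
    rewrites "comm_monoid_set.F (+) 0 = sum"
    by standard[1] (auto simp add: sum_def)
  have "(\<Sum>K\<in>D. increment f K) = (\<Sum>K\<in>D. ?f K)"
  proof (intro sum.cong refl)
    fix K assume K: "K \<in> D"
    then obtain u v where "K = cbox u v" using assms(1) by blast
    moreover have "K \<noteq> {}" using K assms(1) by blast
    ultimately show "increment f K = ?f K" by auto
  qed
  also have "\<dots> = ?f {a..b}" by (rule division [OF assms(1)])
  finally show ?thesis using assms(2) by simp
qed

lemma division_of_real_memberE:
  fixes D :: "real set set"
  assumes "D division_of S" "K \<in> D"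
  obtains u v where "K = {u..v}" "u \<le> v" "{u..v} \<subseteq> S"
proof -
  obtain u v where "K = cbox u v" using assms by blast
  moreover have "K \<noteq> {}" "K \<subseteq> S" using assms by blast+
  ultimately show thesis using that by auto
qed

lemma sum_content_lebesgue:
  assumes "D division_of S"
  shows "sum content D = sum (measure lebesgue) D"
proof (intro sum.cong refl)
  fix K assume "K \<in> D"
  then obtain u v where "K = cbox u v" using assms by blast
  then show "content K = measure lebesgue K" by simp
qed

text \<open>Carries the condition on indexed families of endpoints over to divisions: a finite
  division is enumerated, and cells with disjoint interiors yield disjoint open intervals of total
  length \<open>sum content D\<close>. All later uses of absolute continuity in terms of divisions
  go through this form.\<close>

lemma abs_cont_division:
  assumes "abs_cont_on_interval a b f" "\<epsilon> > 0"
  shows "\<exists>\<delta>>0. \<forall>D. D division_of \<Union>D \<longrightarrow> \<Union>D \<subseteq> {a..b} \<longrightarrow> sum content D < \<delta>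
           \<longrightarrow> (\<Sum>K\<in>D. \<bar>increment f K\<bar>) < \<epsilon>"
proof -
  obtain \<delta> where "\<delta> > 0" and \<delta>0: "\<forall>(n::nat) (u::nat \<Rightarrow> real) v. (\<forall>i<n. a \<le> u i \<and> u i \<le> v i \<and> v i \<le> b) \<and>
      (\<forall>i<n. \<forall>j<n. i \<noteq> j \<longrightarrow> {u i<..<v i} \<inter> {u j<..<v j} = {}) \<and>
      (\<Sum>i<n. v i - u i) < \<delta> \<longrightarrow> (\<Sum>i<n. \<bar>f (v i) - f (u i)\<bar>) < \<epsilon>"
    using assms unfolding abs_cont_on_interval_def by blast
  have \<delta>: "(\<Sum>i<n. \<bar>f (v i) - f (u i)\<bar>) < \<epsilon>"
    if "\<And>i. i < n \<Longrightarrow> a \<le> u i \<and> u i \<le> v i \<and> v i \<le> b"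
      "\<And>i j. \<lbrakk>i < n; j < n; i \<noteq> j\<rbrakk> \<Longrightarrow> {u i<..<v i} \<inter> {u j<..<v j} = {}"
      "(\<Sum>i<n. v i - u i) < \<delta>" for n :: nat and u v :: "nat \<Rightarrow> real"
    using that by (intro \<delta>0 [rule_format]) blast
  show ?thesis
  proof (intro exI [of _ \<delta>] conjI allI impI \<open>\<delta> > 0\<close>)
    fix D :: "real set set" assume D: "D division_of \<Union>D" "\<Union>D \<subseteq> {a..b}" "sum content D < \<delta>"
    then have "finite D" by blast
    then obtain h where h: "bij_betw h {..<card D} D"
      using ex_bij_betw_nat_finite [of D] by (auto simp: atLeast0LessThan)
    have mem: "h i \<in> D" if "i < card D" for i
      using h that by (auto simp: bij_betw_def)
    have K: "K = {Inf K..Sup K} \<and> a \<le> Inf K \<and> Inf K \<le> Sup K \<and> Sup K \<le> b" if "K \<in> D" for K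
    proof -
      obtain u v where "K = {u..v}" "u \<le> v" "{u..v} \<subseteq> \<Union>D"
        using division_of_real_memberE [OF D(1) \<open>K \<in> D\<close>] .
      with D(2) have "{u..v} \<subseteq> {a..b}" by blast
      with \<open>K = {u..v}\<close> \<open>u \<le> v\<close> show ?thesis by auto
    qed
    have "(\<Sum>i<card D. \<bar>f (Sup (h i)) - f (Inf (h i))\<bar>) < \<epsilon>"
    proof (rule \<delta>)
      show "a \<le> Inf (h i) \<and> Inf (h i) \<le> Sup (h i) \<and> Sup (h i) \<le> b" if "i < card D" for i
        using K [OF mem [OF that]] by blast
      show "{Inf (h i)<..<Sup (h i)} \<inter> {Inf (h j)<..<Sup (h j)} = {}"
        if "i < card D" "j < card D" "i \<noteq> j" for i j
      proof -
        have "h i \<noteq> h j" using h that by (auto simp: bij_betw_def inj_on_def)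
        then have "interior (h i) \<inter> interior (h j) = {}"
          using D(1) mem that by blast
        then show ?thesis
          by (metis K mem that(1,2) interior_atLeastAtMost_real)
      qed
      have "(\<Sum>i<card D. Sup (h i) - Inf (h i)) = (\<Sum>K\<in>D. Sup K - Inf K)"
        by (rule sum.reindex_bij_betw [OF h])
      also have "\<dots> = sum content D"
      proof (intro sum.cong refl)
        fix K assume "K \<in> D"
        then show "Sup K - Inf K = content K"
          using K [of K] by (metis content_real)
      qed
      finally show "(\<Sum>i<card D. Sup (h i) - Inf (h i)) < \<delta>" using D(3) by simp
    qed
    also have "(\<Sum>i<card D. \<bar>f (Sup (h i)) - f (Inf (h i))\<bar>) = (\<Sum>K\<in>D. \<bar>f (Sup K) - f (Inf K)\<bar>)"
      by (rule sum.reindex_bij_betw [OF h])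
    also have "\<dots> = (\<Sum>K\<in>D. \<bar>increment f K\<bar>)"
      using D(1) by (intro sum.cong) (auto simp: increment_def)
    finally show "(\<Sum>K\<in>D. \<bar>increment f K\<bar>) < \<epsilon>" .
  qed
qed


text \<open>A gauge argument treating two kinds of tags separately. At tags outside \<open>N\<close>
  the derivative controls each cell up to a multiple of its length; at tags in \<open>N\<close> the
  cells are confined to an open set of small measure, where absolute continuity makes the total
  increment small.\<close>

theorem abs_cont_has_integral:
  assumes ac: "abs_cont_on_interval a b h" and "a \<le> b" and N: "negligible N"
    and der: "\<And>x. x \<in> {a..b} - N \<Longrightarrow> (h has_real_derivative g x) (at x within {a..b})"
  shows "(g has_integral h b - h a) {a..b}"
proof -
  \<comment> \<open>With the integrand 0 on \<open>N\<close>, a cell tagged in \<open>N\<close>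
    contributes only its increment of \<open>h\<close> to the error.\<close>
  define g' where "g' x = (if x \<in> N then 0 else g x)" for x
  have "(g' has_integral h b - h a) {a..b}"
    unfolding has_integral_real
  proof (intro allI impI)
    fix e :: real assume "e > 0"
    \<comment> \<open>Half of \<open>e\<close> is kept for the tags in \<open>N\<close>. The summand
      1 keeps the denominator positive when \<open>a = b\<close>, and \<open>e' * (b - a)\<close> is
      still at most \<open>e / 2\<close>.\<close>
    define e' where "e' = e / 2 / (b - a + 1)"
    have "e' > 0" using \<open>e > 0\<close> \<open>a \<le> b\<close> by (simp add: e'_def)
    obtain \<delta> where "\<delta> > 0" and \<delta>: "\<And>D. \<lbrakk>D division_of \<Union>D; \<Union>D \<subseteq> {a..b}; sum content D < \<delta>\<rbrakk>
          \<Longrightarrow> (\<Sum>K\<in>D. \<bar>increment h K\<bar>) < e / 2"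
      using abs_cont_division [OF ac half_gt_zero [OF \<open>e > 0\<close>]] by blast
    obtain U where U: "open U" "N \<subseteq> U" "U - N \<in> lmeasurable" "emeasure lebesgue (U - N) < ennreal \<delta>"
      using sets_lebesgue_outer_open [OF negligible_imp_sets [OF N] \<open>\<delta> > 0\<close>] .
    have U_eq: "U = (U - N) \<union> N" using U by auto
    have Um: "U \<in> lmeasurable"
      using U(3) negligible_imp_measurable [OF N] by (subst U_eq) (rule fmeasurable.Un)
    have "measure lebesgue (U - N) < \<delta>"
      using U(3,4) \<open>\<delta> > 0\<close> by (simp add: emeasure_eq_measure2 fmeasurableD2 ennreal_less_iff)
    moreover have "measure lebesgue U \<le> measure lebesgue (U - N)"
      using measure_Un_le [of "U - N" lebesgue N] U(3) negligible_imp_sets [OF N] negligible_imp_measure0 [OF N] U_eq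
      by (simp add: fmeasurableD)
    ultimately have mU: "measure lebesgue U < \<delta>" by simp
    have "\<exists>d>0. \<forall>y\<in>{a..b}. \<bar>y - x\<bar> < d \<longrightarrow> \<bar>h y - h x - g x * (y - x)\<bar> \<le> e' * \<bar>y - x\<bar>"
      if "x \<in> {a..b} - N" for x
      using der [OF that] \<open>e' > 0\<close>
      unfolding has_field_derivative_def has_derivative_within_alt by (auto simp: real_norm_def)
    then obtain d where d: "\<And>x. x \<in> {a..b} - N \<Longrightarrow> d x > 0"
      "\<And>x y. \<lbrakk>x \<in> {a..b} - N; y \<in> {a..b}; \<bar>y - x\<bar> < d x\<rbrakk> \<Longrightarrow> \<bar>h y - h x - g x * (y - x)\<bar> \<le> e' * \<bar>y - x\<bar>"
      by metis
    \<comment> \<open>The value \<open>UNIV\<close> only completes the gauge off the interval, where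
      no tag lies.\<close>
    define \<gamma> where "\<gamma> x = (if x \<in> N then U else if x \<in> {a..b} then ball x (d x) else UNIV)" for x
    show "\<exists>\<gamma>. gauge \<gamma> \<and> (\<forall>\<D>. \<D> tagged_division_of {a..b} \<and> \<gamma> fine \<D> \<longrightarrow>
               norm ((\<Sum>(x, k)\<in>\<D>. content k *\<^sub>R g' x) - (h b - h a)) < e)"
    proof (intro exI conjI allI impI; (elim conjE)?)
      show "gauge \<gamma>"
        unfolding gauge_def \<gamma>_def using U d(1) by auto
      fix p assume p: "p tagged_division_of {a..b}" and fine: "\<gamma> fine p"
      define pN where "pN = {xk \<in> p. fst xk \<in> N}"
      have "finite p" using p by blast
      have "pN \<subseteq> p" by (auto simp: pN_def)
      let ?R = "\<lambda>(x,K). content K *\<^sub>R g' x - increment h K"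
      have "(\<Sum>(x, k)\<in>p. content k *\<^sub>R g' x) - (h b - h a) = (\<Sum>xk\<in>p. ?R xk)"
      proof -
        have "(\<Sum>(x,K)\<in>p. increment h K) = (\<Sum>(x,K)\<in>p. h (Sup K) - h (Inf K))"
          using p by (intro sum.cong) (auto simp: increment_def)
        then show ?thesis
          using additive_tagged_division_1 [OF \<open>a \<le> b\<close> p, of h]
          by (simp add: sum_subtractf split_def)
      qed
      also have "\<dots> = (\<Sum>xk\<in>pN. ?R xk) + (\<Sum>xk\<in>p - pN. ?R xk)"
        using sum.subset_diff [OF \<open>pN \<subseteq> p\<close> \<open>finite p\<close>, of ?R] by linarith
      finally have eq: "(\<Sum>(x, k)\<in>p. content k *\<^sub>R g' x) - (h b - h a)
          = (\<Sum>xk\<in>pN. ?R xk) + (\<Sum>xk\<in>p - pN. ?R xk)" .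
      have pNp: "pN tagged_division_of (\<Union>(snd ` pN))"
        using p tagged_partial_division_of_Union_self [OF tagged_partial_division_subset [OF _ \<open>pN \<subseteq> p\<close>]]
        unfolding tagged_division_of_def [of p] by blast
      have divN: "snd ` pN division_of (\<Union>(snd ` pN))"
        using division_of_tagged_division [OF pNp] .
      have sub: "\<Union>(snd ` pN) \<subseteq> U \<inter> {a..b}"
        using fine p by (fastforce simp: pN_def \<gamma>_def fine_def)
      have "sum content (snd ` pN) = measure lebesgue (\<Union>(snd ` pN))"
        using content_division [OF divN] sum_content_lebesgue [OF divN] by simp
      also have "\<dots> \<le> measure lebesgue U"
        using sub Um divN by (intro measure_mono_fmeasurable) (auto simp: lmeasurable_division fmeasurableD)
      finally have "(\<Sum>K\<in>snd ` pN. \<bar>increment h K\<bar>) < e / 2"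
        using \<delta> [OF divN] sub mU by auto
      \<comment> \<open>Two different tagged pairs can share a cell only if it has empty interior,
        and there the increment is 0, so forgetting the tags does not change the sum.\<close>
      also have "(\<Sum>K\<in>snd ` pN. \<bar>increment h K\<bar>) = (\<Sum>(x,K)\<in>pN. \<bar>increment h K\<bar>)"
      proof (rule sum.over_tagged_division_lemma [OF pNp, symmetric])
        fix u v :: real assume "box u v = {}"
        then show "\<bar>increment h (cbox u v)\<bar> = 0"
          by (cases "u = v") (auto simp: increment_def)
      qed
      finally have 1: "\<bar>\<Sum>xk\<in>pN. ?R xk\<bar> < e / 2"
      proof (rule le_less_trans [rotated])
        have "\<bar>\<Sum>xk\<in>pN. ?R xk\<bar> \<le> (\<Sum>xk\<in>pN. \<bar>?R xk\<bar>)" by (rule sum_abs)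
        also have "\<dots> = (\<Sum>(x,K)\<in>pN. \<bar>increment h K\<bar>)"
          by (intro sum.cong) (auto simp: pN_def g'_def)
        finally show "\<bar>\<Sum>xk\<in>pN. ?R xk\<bar> \<le> (\<Sum>(x,K)\<in>pN. \<bar>increment h K\<bar>)" .
      qed
      have "\<bar>\<Sum>xk\<in>p - pN. ?R xk\<bar> \<le> (\<Sum>xk\<in>p - pN. \<bar>?R xk\<bar>)" by (rule sum_abs)
      also have "\<dots> \<le> (\<Sum>xk\<in>p - pN. e' * content (snd xk))"
      proof (rule sum_mono)
        fix xk assume xk: "xk \<in> p - pN"
        obtain x K where xK: "xk = (x, K)" by force
        with xk have "(x, K) \<in> p" "x \<notin> N" by (auto simp: pN_def)
        then obtain u v where uv: "K = {u..v}" "x \<in> {u..v}" "{u..v} \<subseteq> {a..b}"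
          using p by (metis tagged_division_ofD(2,3,4) box_real(2))
        then have ux: "u \<le> x" "x \<le> v" "x \<in> {a..b} - N" "u \<in> {a..b}" "v \<in> {a..b}"
          using \<open>x \<notin> N\<close> by auto
        have "{u..v} \<subseteq> ball x (d x)"
          using fineD [OF fine \<open>(x, K) \<in> p\<close>] uv ux \<open>x \<notin> N\<close> by (auto simp: \<gamma>_def split: if_splits)
        moreover have "u \<in> {u..v}" "v \<in> {u..v}" using ux by auto
        ultimately have "u \<in> ball x (d x)" "v \<in> ball x (d x)" by blast+
        then have "\<bar>u - x\<bar> < d x" "\<bar>v - x\<bar> < d x" by (auto simp: dist_real_def)
        then have "\<bar>h u - h x - g x * (u - x)\<bar> \<le> e' * \<bar>u - x\<bar>"
          "\<bar>h v - h x - g x * (v - x)\<bar> \<le> e' * \<bar>v - x\<bar>"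
          using d(2) ux by blast+
        then have "\<bar>(v - u) * g x - (h v - h u)\<bar> \<le> e' * (v - u)"
          using ux(1,2) by (simp add: algebra_simps)
        then show "\<bar>?R xk\<bar> \<le> e' * content (snd xk)"
          using uv ux \<open>x \<notin> N\<close> by (simp add: xK g'_def)
      qed
      also have "\<dots> \<le> (\<Sum>xk\<in>p. e' * content (snd xk))"
        using \<open>finite p\<close> \<open>e' > 0\<close> by (intro sum_mono2) auto
      also have "\<dots> = e' * (b - a)"
        using additive_content_tagged_division [of p a b] p \<open>a \<le> b\<close>
        by (simp add: sum_distrib_left [symmetric] split_def)
      also have "\<dots> \<le> e / 2"
        using \<open>a \<le> b\<close> \<open>e > 0\<close> by (simp add: e'_def field_simps)
      finally show "norm ((\<Sum>(x, k)\<in>p. content k *\<^sub>R g' x) - (h b - h a)) < e"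
        unfolding eq real_norm_def using 1 by linarith
    qed
  qed
  then show ?thesis
    by (rule has_integral_spike [OF N, rotated]) (auto simp: g'_def)
qed

section \<open>Almost everywhere differentiability\<close>

definition fine_interval_cover :: "real set set \<Rightarrow> real set \<Rightarrow> bool" where
  "fine_interval_cover K S \<longleftrightarrow>
     (\<forall>x\<in>S. \<forall>e>0. \<exists>u v. u < v \<and> v - u < e \<and> x \<in> {u..v} \<and> {u..v} \<in> K)"

text \<open>A nonnegligible set has outer measure at least some \<mu> > 0. Vitali's theorem gives
  countably many disjoint intervals of the cover exhausting \<open>S\<close> up to a null set, and
  finitely many of them lose at most half of \<mu>. The bound is chosen before the cover
  \<open>K\<close> and the null set \<open>Z\<close>, so covers may be built from constants that
  depend on it.\<close>

lemma vitali_interval_selection: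
  fixes S :: "real set"
  assumes "\<not> negligible S"
  shows "\<exists>\<mu>>0. \<forall>K Z c d. negligible Z \<longrightarrow> \<Union>K \<subseteq> {c..d} \<longrightarrow> fine_interval_cover K (S - Z)
           \<longrightarrow> (\<exists>G\<subseteq>K. G division_of \<Union>G \<and> \<mu> \<le> sum content G)"
proof -
  obtain \<mu> where "\<mu> > 0" and \<mu>: "\<And>T. \<lbrakk>S \<subseteq> T; T \<in> lmeasurable\<rbrakk> \<Longrightarrow> \<mu> \<le> measure lebesgue T"
    using assms unfolding negligible_outer by (meson not_less)
  have "\<exists>G\<subseteq>K. G division_of \<Union>G \<and> \<mu> / 2 \<le> sum content G"
    if Z: "negligible Z" and sub: "\<Union>K \<subseteq> {c..d}" and cov: "fine_interval_cover K (S - Z)" for K Z c d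
  proof -
    \<comment> \<open>The covering theorem is about indexed balls, so each interval is indexed by
      its endpoints and regarded as the closed ball around its midpoint.\<close>
    define P where "P = {(u, v). u < v \<and> {u..v} \<in> K}"
    define m r where "m = (\<lambda>(u, v). (u + v) / 2 :: real)" and "r = (\<lambda>(u, v). (v - u) / 2 :: real)"
    have cb: "cball (m p) (r p) = {fst p..snd p}" for p
    proof -
      have "(fst p + snd p) / 2 - (snd p - fst p) / 2 = fst p"
        "(fst p + snd p) / 2 + (snd p - fst p) / 2 = snd p"
        by (simp_all add: field_simps)
      then show ?thesis by (simp add: cball_eq_atLeastAtMost m_def r_def split_def)
    qed
    have rpos: "0 < r p" if "p \<in> P" for p
      using that by (auto simp: P_def r_def)
    have cov': "\<exists>p. p \<in> P \<and> x \<in> cball (m p) (r p) \<and> r p < e" if xe: "x \<in> S - Z" "e > 0" for x e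
    proof -
      obtain u v where "u < v" "v - u < e" "x \<in> {u..v}" "{u..v} \<in> K"
        using cov xe unfolding fine_interval_cover_def by blast
      then show ?thesis
        unfolding cb by (intro exI [of _ "(u, v)"]) (auto simp: P_def r_def)
    qed
    obtain C where C: "countable C" "C \<subseteq> P"
      "pairwise (\<lambda>i j. disjnt (cball (m i) (r i)) (cball (m j) (r j))) C"
      "negligible (S - Z - (\<Union>i\<in>C. cball (m i) (r i)))"
      by (rule Vitali_covering_theorem_cballs [of P r "S - Z" m, OF rpos cov'])
    define \<D> where "\<D> = (\<lambda>p. {fst p..snd p}) ` C"
    have \<D>K: "\<D> \<subseteq> K" using C(2) by (auto simp: \<D>_def P_def)
    have \<D>int: "\<exists>u v. u < v \<and> k = {u..v}" if k: "k \<in> \<D>" for k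
    proof -
      obtain p where "p \<in> C" "k = {fst p..snd p}" using k unfolding \<D>_def by blast
      moreover have "fst p < snd p" using \<open>p \<in> C\<close> C(2) by (auto simp: P_def)
      ultimately show ?thesis by blast
    qed
    have \<D>disj: "disjnt k k'" if kk: "k \<in> \<D>" "k' \<in> \<D>" "k \<noteq> k'" for k k'
    proof -
      obtain p p' where p: "p \<in> C" "p' \<in> C" "k = {fst p..snd p}" "k' = {fst p'..snd p'}"
        using kk unfolding \<D>_def by blast
      with kk(3) have "p \<noteq> p'" by blast
      with C(3) p show ?thesis unfolding pairwise_def cb by simp
    qed
    have \<D>m: "k \<in> lmeasurable" if "k \<in> \<D>" for k
      using \<D>int [OF that] by auto
    have "countable \<D>" using C(1) by (simp add: \<D>_def)
    have D'le: "measure lebesgue (\<Union>D') \<le> measure lebesgue {c..d}" if "D' \<subseteq> \<D>" "finite D'" for D'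
      using that \<D>K sub \<D>m
      by (intro measure_mono_fmeasurable) (auto intro!: sets.finite_Union dest: fmeasurableD)
    obtain G where G: "G \<subseteq> \<D>" "finite G" "measure lebesgue (\<Union>\<D>) - \<mu> / 2 < measure lebesgue (\<Union>G)"
      by (rule measure_countable_Union_approachable [OF \<open>countable \<D>\<close> half_gt_zero [OF \<open>\<mu> > 0\<close>] \<D>m D'le])
    have "\<Union>\<D> \<in> lmeasurable"
    proof (rule bounded_set_imp_lmeasurable)
      show "bounded (\<Union>\<D>)" using \<D>K sub by (intro bounded_subset [OF bounded_closed_interval [of c d]]) blast
      show "\<Union>\<D> \<in> sets lebesgue" using \<open>countable \<D>\<close> \<D>m by (intro sets.countable_Union) auto
    qed
    define N where "N = (S - Z - \<Union>\<D>) \<union> Z"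
    have "\<Union>\<D> = (\<Union>i\<in>C. cball (m i) (r i))" by (simp add: \<D>_def cb)
    then have "negligible N" using C(4) Z by (simp add: N_def)
    \<comment> \<open>Adding the null set \<open>N\<close> makes the union a measurable superset of
      all of \<open>S\<close>, as the lower bound on the outer measure demands.\<close>
    have "\<mu> \<le> measure lebesgue (\<Union>\<D> \<union> N)"
      using \<open>\<Union>\<D> \<in> lmeasurable\<close> negligible_imp_measurable [OF \<open>negligible N\<close>]
      by (intro \<mu>) (auto simp: N_def intro: fmeasurable.Un)
    also have "\<dots> \<le> measure lebesgue (\<Union>\<D>)"
      using measure_Un_le [of "\<Union>\<D>" lebesgue N] \<open>\<Union>\<D> \<in> lmeasurable\<close>
        negligible_imp_sets [OF \<open>negligible N\<close>] negligible_imp_measure0 [OF \<open>negligible N\<close>]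
      by (simp add: fmeasurableD)
    finally have "\<mu> / 2 \<le> measure lebesgue (\<Union>G)" using G(3) by linarith
    have Gdiv: "G division_of \<Union>G"
    proof (rule division_ofI)
      show "interior k \<inter> interior k' = {}" if "k \<in> G" "k' \<in> G" "k \<noteq> k'" for k k'
        using \<D>disj [of k k'] that G(1) interior_subset unfolding disjnt_def by blast
      show "k \<noteq> {}" if "k \<in> G" for k using \<D>int [of k] that G(1) by fastforce
      show "\<exists>a b. k = cbox a b" if "k \<in> G" for k using \<D>int [of k] that G(1) by (metis box_real(2) subsetD)
    qed (use G in auto)
    have "\<mu> / 2 \<le> sum content G"
      using \<open>\<mu> / 2 \<le> measure lebesgue (\<Union>G)\<close> content_division [OF Gdiv] sum_content_lebesgue [OF Gdiv] by simp
    moreover have "G \<subseteq> K" using G(1) \<D>K by blast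
    ultimately show ?thesis using Gdiv by blast
  qed
  then show ?thesis
    using \<open>\<mu> > 0\<close> by (intro exI [of _ "\<mu> / 2"] conjI allI impI) (simp, blast)
qed

section \<open>Exceptional sets of the difference quotients\<close>

lemma slope_interval:
  fixes x y :: real
  assumes "y \<noteq> x" "\<bar>y - x\<bar> < e"
  shows "\<exists>u v. u < v \<and> v - u < e \<and> x \<in> {u..v} \<and> {u..v} \<subseteq> ball x e \<and> v - u = \<bar>y - x\<bar> \<and> \<bar>f v - f u\<bar> = \<bar>f y - f x\<bar>
           \<and> (f v - f u) / (v - u) = (f y - f x) / (y - x)"
proof (cases "x < y")
  case True
  with assms show ?thesis by (intro exI [of _ x] exI [of _ y]) (auto simp: dist_real_def)
next
  case False
  have "(f x - f y) / (x - y) = (f y - f x) / (y - x)"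
    using assms by (simp add: field_simps)
  with False assms show ?thesis by (intro exI [of _ y] exI [of _ x]) (auto simp: dist_real_def)
qed

text \<open>Otherwise Vitali selects nonoverlapping intervals of total length at least a fixed \<mu>
  on which the increment exceeds \<open>M\<close> times the length. For large \<open>M\<close> their
  increments alone exceed the bound \<open>B\<close> on the variation.\<close>

lemma negligible_unbounded_slopes:
  assumes bv: "\<And>D. D division_of {c..d} \<Longrightarrow> (\<Sum>K\<in>D. \<bar>increment f K\<bar>) \<le> B"
  shows "negligible {x\<in>{c<..<d}. \<forall>M. \<forall>e>0. \<exists>y. y \<noteq> x \<and> \<bar>y - x\<bar> < e \<and> M * \<bar>y - x\<bar> < \<bar>f y - f x\<bar>}"
    (is "negligible ?E")
proof (rule ccontr)
  assume "\<not> negligible ?E"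
  then obtain \<mu> where "\<mu> > 0" and \<mu>: "\<And>K Z c d. \<lbrakk>negligible Z; \<Union>K \<subseteq> {c..d}; fine_interval_cover K (?E - Z)\<rbrakk>
      \<Longrightarrow> \<exists>G\<subseteq>K. G division_of \<Union>G \<and> \<mu> \<le> sum content G"
    using vitali_interval_selection [of ?E] by blast
  \<comment> \<open>Chosen so that \<open>M * \<mu>\<close> equals \<open>\<bar>B\<bar> + 1\<close>,
    which is larger than \<open>B\<close>.\<close>
  define M where "M = (\<bar>B\<bar> + 1) / \<mu>"
  have "M > 0" using \<open>\<mu> > 0\<close> by (simp add: M_def add_nonneg_pos)
  define K where "K = {{u..v} | u v. u < v \<and> {u..v} \<subseteq> {c..d} \<and> M * (v - u) < \<bar>f v - f u\<bar>}"
  have cov: "fine_interval_cover K (?E - {})"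
    unfolding fine_interval_cover_def
  proof (intro ballI allI impI)
    fix x and e :: real assume x: "x \<in> ?E - {}" and "e > 0"
    have "x \<in> {c<..<d}" using x by blast
    then obtain e0 where e0: "e0 > 0" "ball x e0 \<subseteq> {c<..<d}"
      by (meson open_contains_ball open_greaterThanLessThan)
    have "0 < min e e0" using e0 \<open>e > 0\<close> by simp
    then obtain y where y: "y \<noteq> x" "\<bar>y - x\<bar> < min e e0" "M * \<bar>y - x\<bar> < \<bar>f y - f x\<bar>"
      using x by blast
    \<comment> \<open>A slope is symmetric in its two points, so the interval between
      \<open>x\<close> and \<open>y\<close> serves on whichever side of \<open>x\<close> the point
      \<open>y\<close> lies.\<close>
    obtain u v where "u < v" "v - u < min e e0" "x \<in> {u..v}" "{u..v} \<subseteq> ball x (min e e0)"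
      "v - u = \<bar>y - x\<bar>" "\<bar>f v - f u\<bar> = \<bar>f y - f x\<bar>"
      using slope_interval [OF y(1,2), of f] by blast
    moreover have "{u..v} \<subseteq> {c..d}"
    proof -
      have "ball x (min e e0) \<subseteq> ball x e0" by (rule subset_ball) simp
      moreover have "{c<..<d} \<subseteq> {c..d}" by (rule greaterThanLessThan_subseteq_atLeastAtMost_iff [THEN iffD2]) simp
      ultimately show ?thesis using e0(2) \<open>{u..v} \<subseteq> ball x (min e e0)\<close> by blast
    qed
    ultimately show "\<exists>u v. u < v \<and> v - u < e \<and> x \<in> {u..v} \<and> {u..v} \<in> K"
      using y(3) by (intro exI [of _ u] exI [of _ v]) (auto simp: K_def)
  qed
  have "\<Union>K \<subseteq> {c..d}" by (auto simp: K_def)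
  then obtain G where G: "G \<subseteq> K" "G division_of \<Union>G" "\<mu> \<le> sum content G"
    using \<mu> [OF negligible_empty _ cov] by meson
  have "\<Union>G \<subseteq> cbox c d" using G(1) by (auto simp: K_def)
  \<comment> \<open>The bound \<open>B\<close> concerns divisions of the whole interval, so the
    selected intervals are completed to one; the added cells only increase the sum.\<close>
  then obtain Q where Q: "G \<subseteq> Q" "Q division_of cbox c d"
    using partial_division_extend_interval [OF G(2)] by blast
  have "\<bar>B\<bar> + 1 = M * \<mu>" using \<open>\<mu> > 0\<close> by (simp add: M_def)
  also have "\<dots> \<le> M * sum content G" using G(3) \<open>M > 0\<close> by simp
  also have "\<dots> = (\<Sum>k\<in>G. M * content k)" by (rule sum_distrib_left)
  also have "\<dots> \<le> (\<Sum>k\<in>G. \<bar>increment f k\<bar>)"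
    using G(1) by (intro sum_mono) (fastforce simp: K_def)
  also have "\<dots> \<le> (\<Sum>k\<in>Q. \<bar>increment f k\<bar>)"
    using Q by (intro sum_mono2) auto
  also have "\<dots> \<le> B" using bv Q(2) by simp
  finally show False by simp
qed

text \<open>Thresholds on both sides of 0 guarantee, near every point of the set, slopes of the sign
  opposite to the increment of the surrounding cell, whatever that sign is. Splitting off such
  intervals of total length \<mu> raises the variation by at least \<open>k * \<mu>\<close>, more
  than an almost maximal division allows.\<close>

lemma negligible_oscillating_slopes:
  assumes bv: "\<And>D. D division_of {c..d} \<Longrightarrow> (\<Sum>J\<in>D. \<bar>increment f J\<bar>) \<le> B" and "k > 0"
  shows "negligible {x\<in>{c<..<d}. \<forall>e>0.
           (\<exists>y. y \<noteq> x \<and> \<bar>y - x\<bar> < e \<and> (f y - f x) / (y - x) < - k) \<and>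
           (\<exists>y. y \<noteq> x \<and> \<bar>y - x\<bar> < e \<and> k < (f y - f x) / (y - x))}"
    (is "negligible ?E")
proof (rule ccontr)
  assume nonnegl: "\<not> negligible ?E"
  then obtain \<mu> where "\<mu> > 0" and \<mu>: "\<And>K Z c d. \<lbrakk>negligible Z; \<Union>K \<subseteq> {c..d}; fine_interval_cover K (?E - Z)\<rbrakk>
      \<Longrightarrow> \<exists>G\<subseteq>K. G division_of \<Union>G \<and> \<mu> \<le> sum content G"
    using vitali_interval_selection [of ?E] by blast
  have "?E \<noteq> {}" using nonnegl by (metis negligible_empty)
  then have "c < d" by auto
  define var where "var D = (\<Sum>J\<in>D. \<bar>increment f J\<bar>)" for D
  have bdd: "bdd_above (var ` {D. D division_of {c..d}})"
    using bv by (intro bdd_aboveI [of _ B]) (auto simp: var_def)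
  have "{{c..d}} division_of {c..d}"
    using division_of_self [of c d] \<open>c < d\<close> by simp
  then have ne: "var ` {D. D division_of {c..d}} \<noteq> {}" by blast
  have "k * \<mu> > 0" using \<open>k > 0\<close> \<open>\<mu> > 0\<close> by simp
  then have "Sup (var ` {D. D division_of {c..d}}) - k * \<mu> < Sup (var ` {D. D division_of {c..d}})" by simp
  \<comment> \<open>The tolerance \<open>k * \<mu>\<close> is exactly the gain that the refinement
    \<open>D\<close> below will produce.\<close>
  then obtain P where P: "P division_of {c..d}" and Pvar: "Sup (var ` {D. D division_of {c..d}}) - k * \<mu> < var P"
    using less_cSup_iff [OF ne bdd] by auto
  have Pint: "\<exists>u v. J = {u..v} \<and> u \<le> v \<and> {u..v} \<subseteq> {c..d}" if "J \<in> P" for J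
    using division_of_real_memberE [OF P that] by metis
  have "finite P" using P by (rule division_ofD(1))
  \<comment> \<open>A point that is not an endpoint of a cell lies in the interior of its cell, so
    sufficiently short intervals around it stay inside. The finitely many endpoints are discarded as
    a null set.\<close>
  define Z where "Z = Inf ` P \<union> Sup ` P"
  have "negligible Z" using \<open>finite P\<close> by (simp add: Z_def negligible_finite)
  \<comment> \<open>Inside a cell \<open>J\<close> an interval whose slope opposes the increment of \<open>J\<close> forces the remaining pieces
    of \<open>J\<close> to make up for it.\<close>
  define against where "against J u v \<longleftrightarrow>
      (if 0 \<le> increment f J then f v - f u \<le> - (k * (v - u)) else k * (v - u) \<le> f v - f u)" for J u v
  define K where "K = {{u..v} | u v. u < v \<and> (\<exists>J\<in>P. {u..v} \<subseteq> J \<and> against J u v)}"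
  have cov: "fine_interval_cover K (?E - Z)"
    unfolding fine_interval_cover_def
  proof (intro ballI allI impI)
    fix x and e :: real assume x: "x \<in> ?E - Z" and "e > 0"
    then have "x \<in> {c..d}" by auto
    then obtain J where J: "J \<in> P" "x \<in> J" using division_ofD(6) [OF P] by blast
    then obtain a b where ab: "J = {a..b}" "a \<le> b" using Pint by blast
    have "x \<noteq> a" "x \<noteq> b" using x J ab by (auto simp: Z_def image_iff)
    then have "a < x" "x < b" using J ab by auto
    define e1 where "e1 = min e (min (x - a) (b - x))"
    have "e1 > 0" using \<open>a < x\<close> \<open>x < b\<close> \<open>e > 0\<close> by (simp add: e1_def)
    have "\<exists>y. y \<noteq> x \<and> \<bar>y - x\<bar> < e1 \<and> (if 0 \<le> increment f J then (f y - f x) / (y - x) < - k else k < (f y - f x) / (y - x))"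
      using x \<open>e1 > 0\<close> by (cases "0 \<le> increment f J") auto
    then obtain y where y: "y \<noteq> x" "\<bar>y - x\<bar> < e1"
      "if 0 \<le> increment f J then (f y - f x) / (y - x) < - k else k < (f y - f x) / (y - x)"
      by metis
    obtain u v where uv: "u < v" "v - u < e1" "x \<in> {u..v}" "{u..v} \<subseteq> ball x e1"
        "(f v - f u) / (v - u) = (f y - f x) / (y - x)"
      using slope_interval [OF y(1,2), of f] by metis
    have "against J u v"
      using y(3) uv(1) unfolding uv(5) [symmetric] against_def
      by (auto simp: field_simps split: if_splits)
    moreover have "{u..v} \<subseteq> J"
      using uv(1-3) unfolding ab e1_def by auto
    ultimately show "\<exists>u v. u < v \<and> v - u < e \<and> x \<in> {u..v} \<and> {u..v} \<in> K"
      using J(1) uv(1-3) unfolding K_def e1_def by (intro exI [of _ u] exI [of _ v]) auto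
  qed
  have "\<Union>K \<subseteq> {c..d}" using division_ofD(2) [OF P] unfolding K_def by blast
  then obtain G where G: "G \<subseteq> K" "G division_of \<Union>G" "\<mu> \<le> sum content G"
    using \<mu> [OF \<open>negligible Z\<close> _ cov] by meson
  have "finite G" using G(2) by (rule division_ofD(1))
  \<comment> \<open>Membership in \<open>K\<close> supplies some cell \<open>J'\<close> containing
    \<open>g\<close>. Since \<open>g\<close> has nonempty interior it fits into only one cell of
    \<open>P\<close>, so \<open>J'\<close> is the given \<open>J\<close>.\<close>
  have agree: "against J u v" if g: "g \<in> G" "g \<subseteq> J" "J \<in> P" "g = {u..v}" "u \<le> v" for J g u v
  proof -
    obtain u' v' J' where uv': "g = {u'..v'}" "u' < v'" "J' \<in> P" "g \<subseteq> J'" "against J' u' v'"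
      using g(1) G(1) unfolding K_def by blast
    have "u' = u" "v' = v" using uv'(1,2) g(4,5) by (auto simp: Icc_eq_Icc)
    have "interior g \<subseteq> interior J \<inter> interior J'" using g(2) uv'(4) by (simp add: interior_mono)
    moreover have "interior g \<noteq> {}" using uv'(1,2) by simp
    ultimately have "J = J'" using division_ofD(5) [OF P g(3) uv'(3)] by blast
    then show ?thesis using uv'(5) \<open>u' = u\<close> \<open>v' = v\<close> by simp
  qed
  define GJ where "GJ J = {g \<in> G. g \<subseteq> J}" for J
  have "\<exists>Q. GJ J \<subseteq> Q \<and> Q division_of J" if "J \<in> P" for J
  proof -
    obtain a b where "J = cbox a b" using division_ofD(4) [OF P \<open>J \<in> P\<close>] by metis
    moreover have "GJ J division_of \<Union>(GJ J)"
      using division_of_subset [OF G(2), of "GJ J"] by (auto simp: GJ_def)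
    moreover have "\<Union>(GJ J) \<subseteq> J" by (auto simp: GJ_def)
    ultimately show ?thesis using partial_division_extend_interval [of "GJ J" a b] by metis
  qed
  then obtain Q where Q: "\<And>J. J \<in> P \<Longrightarrow> GJ J \<subseteq> Q J" "\<And>J. J \<in> P \<Longrightarrow> Q J division_of J"
    by metis
  \<comment> \<open>The increments over \<open>Q J\<close> add up to that of \<open>J\<close>. As
    the selected pieces go against it by \<open>k\<close> times their length, the other pieces must
    make up the difference, and their absolute increments already give the bound.\<close>
  have gain: "\<bar>increment f J\<bar> + k * sum content (GJ J) \<le> var (Q J)" if "J \<in> P" for J
  proof -
    obtain a b where ab: "J = {a..b}" "a \<le> b" using Pint [OF \<open>J \<in> P\<close>] by blast
    have "finite (Q J)" using Q(2) [OF \<open>J \<in> P\<close>] by (rule division_ofD(1))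
    have "sum (increment f) (Q J) = increment f J"
      using sum_increment_division [of "Q J" a b f] Q(2) [OF \<open>J \<in> P\<close>] ab by simp
    then have rest: "sum (increment f) (Q J - GJ J) = increment f J - sum (increment f) (GJ J)"
      using sum.subset_diff [OF Q(1) [OF \<open>J \<in> P\<close>] \<open>finite (Q J)\<close>, of "increment f"] by linarith
    have each: "if 0 \<le> increment f J then increment f g \<le> - (k * content g) else k * content g \<le> increment f g"
      if g: "g \<in> GJ J" for g
    proof -
      have "g \<in> G" "g \<subseteq> J" using g by (auto simp: GJ_def)
      obtain u v where uv: "g = {u..v}" "u \<le> v"
        using division_of_real_memberE [OF G(2) \<open>g \<in> G\<close>] by metis
      then show ?thesis
        using agree [OF \<open>g \<in> G\<close> \<open>g \<subseteq> J\<close> \<open>J \<in> P\<close> uv] by (simp add: against_def)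
    qed
    have "\<bar>increment f J\<bar> + k * sum content (GJ J) \<le> \<bar>sum (increment f) (Q J - GJ J)\<bar>"
    proof (cases "0 \<le> increment f J")
      case True
      then have "sum (increment f) (GJ J) \<le> (\<Sum>g\<in>GJ J. - (k * content g))"
        using each by (intro sum_mono) auto
      then show ?thesis using True rest by (simp add: sum_negf sum_distrib_left)
    next
      case False
      then have "(\<Sum>g\<in>GJ J. k * content g) \<le> sum (increment f) (GJ J)"
        using each by (intro sum_mono) auto
      then show ?thesis using False rest by (simp add: sum_distrib_left)
    qed
    also have "\<dots> \<le> (\<Sum>g\<in>Q J - GJ J. \<bar>increment f g\<bar>)" by (rule sum_abs)
    also have "\<dots> \<le> var (Q J)"
      unfolding var_def using \<open>finite (Q J)\<close> by (intro sum_mono2) auto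
    finally show ?thesis .
  qed
  define D where "D = \<Union>(Q ` P)"
  have QD: "\<Union>(Q J) = J" if "J \<in> P" for J using division_ofD(6) [OF Q(2) [OF that]] .
  have disj: "interior g \<inter> interior g' = {}" if "J \<in> P" "J' \<in> P" "J \<noteq> J'" "g \<in> Q J" "g' \<in> Q J'" for J J' g g'
  proof -
    have "interior g \<subseteq> interior J" "interior g' \<subseteq> interior J'"
      using QD that by (auto intro!: interior_mono)
    then show ?thesis using division_ofD(5) [OF P that(1-3)] by blast
  qed
  have Ddiv: "D division_of {c..d}"
  proof (rule division_ofI)
    show "finite D" unfolding D_def using \<open>finite P\<close> Q(2) by (auto intro: division_ofD(1))
    show "g \<subseteq> {c..d}" "g \<noteq> {}" "\<exists>a b. g = cbox a b" if gD: "g \<in> D" for g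
    proof -
      obtain J where J: "J \<in> P" "g \<in> Q J" using gD by (auto simp: D_def)
      show "g \<subseteq> {c..d}" using division_ofD(2) [OF Q(2) [OF J(1)] J(2)] division_ofD(2) [OF P J(1)] by blast
      show "g \<noteq> {}" "\<exists>a b. g = cbox a b" using division_ofD(3,4) [OF Q(2) [OF J(1)] J(2)] by auto
    qed
    show "interior g \<inter> interior g' = {}" if g: "g \<in> D" "g' \<in> D" "g \<noteq> g'" for g g'
    proof -
      obtain J J' where J: "J \<in> P" "g \<in> Q J" "J' \<in> P" "g' \<in> Q J'" using g by (auto simp: D_def)
      show ?thesis
        using disj [OF J(1,3) _ J(2,4)] division_ofD(5) [OF Q(2) [OF J(1)] J(2) _ g(3)] J(4) by (cases "J = J'") auto
    qed
    have "\<Union>D = (\<Union>J\<in>P. \<Union>(Q J))" by (auto simp: D_def)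
    also have "\<dots> = \<Union>P" using QD by auto
    finally show "\<Union>D = {c..d}" using division_ofD(6) [OF P] by simp
  qed
  \<comment> \<open>Divisions of different cells can have only degenerate intervals in common, and
    the increment over a single point is 0, so nothing is counted twice.\<close>
  have "var D = (\<Sum>S\<in>Q ` P. var S)"
    unfolding D_def var_def
  proof (subst sum.Union_comp)
    show "\<forall>A\<in>Q ` P. finite A" using Q(2) by (auto intro: division_ofD(1))
    fix A1 A2 g assume A: "A1 \<in> Q ` P" "A2 \<in> Q ` P" "A1 \<noteq> A2" "g \<in> A1" "g \<in> A2"
    then obtain J J' where J: "J \<in> P" "J' \<in> P" "J \<noteq> J'" "g \<in> Q J" "g \<in> Q J'" by blast
    obtain u v where uv: "g = {u..v}" "u \<le> v"
      using division_of_real_memberE [OF Q(2) [OF J(1)] J(4)] by metis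
    have "interior g = {}" using disj [OF J] by simp
    then have "u = v" using uv by simp
    then show "\<bar>increment f g\<bar> = 0" using uv by (simp add: increment_def)
  qed simp
  also have "\<dots> = (\<Sum>J\<in>P. var (Q J))"
  proof -
    have "inj_on Q P" using QD by (metis inj_onI)
    then show ?thesis by (simp add: sum.reindex)
  qed
  finally have varD: "var D = (\<Sum>J\<in>P. var (Q J))" .
  \<comment> \<open>Every selected interval lies in at least one cell of \<open>P\<close>; an
    inequality suffices, so uniqueness of the cell need not enter.\<close>
  have "sum content G \<le> (\<Sum>g\<in>G. \<Sum>J\<in>{J\<in>P. g \<subseteq> J}. content g)"
  proof (rule sum_mono)
    fix g assume "g \<in> G"
    then obtain J where "J \<in> {J\<in>P. g \<subseteq> J}" using G(1) unfolding K_def by blast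
    then show "content g \<le> (\<Sum>J\<in>{J\<in>P. g \<subseteq> J}. content g)"
      using \<open>finite P\<close> by (intro member_le_sum [of J _ "\<lambda>_. content g"]) auto
  qed
  also have "\<dots> = (\<Sum>J\<in>P. sum content (GJ J))"
    unfolding GJ_def by (rule sum.swap_restrict [OF \<open>finite G\<close> \<open>finite P\<close>])
  finally have "k * \<mu> \<le> k * (\<Sum>J\<in>P. sum content (GJ J))"
    using G(3) \<open>k > 0\<close> by simp
  then have "var P + k * \<mu> \<le> (\<Sum>J\<in>P. \<bar>increment f J\<bar> + k * sum content (GJ J))"
    by (simp add: var_def sum.distrib sum_distrib_left)
  also have "\<dots> \<le> var D"
    unfolding varD using gain by (rule sum_mono)
  also have "\<dots> \<le> Sup (var ` {D. D division_of {c..d}})"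
    using bdd Ddiv by (intro cSup_upper) auto
  finally show False using Pvar by simp
qed

text \<open>If the lower and upper limits of the slopes differed, two rationals would fit between
  them and the slopes would cross both arbitrarily close to \<open>x\<close>. The common value is
  taken in \<open>ereal\<close>; boundedness of the slopes makes it finite. Rational thresholds
  leave only countably many exceptional sets.\<close>

lemma differentiable_from_slopes:
  fixes f :: "real \<Rightarrow> real"
  assumes bounded: "\<not> (\<forall>M. \<forall>e>0. \<exists>y. y \<noteq> x \<and> \<bar>y - x\<bar> < e \<and> M * \<bar>y - x\<bar> < \<bar>f y - f x\<bar>)"
    and osc: "\<And>p q. \<lbrakk>p \<in> \<rat>; q \<in> \<rat>; p < q\<rbrakk> \<Longrightarrow> \<not> (\<forall>e>0.
           (\<exists>y. y \<noteq> x \<and> \<bar>y - x\<bar> < e \<and> (f y - f x) / (y - x) < p) \<and>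
           (\<exists>y. y \<noteq> x \<and> \<bar>y - x\<bar> < e \<and> q < (f y - f x) / (y - x)))"
  shows "f differentiable at x"
proof -
  define s where "s y = (f y - f x) / (y - x)" for y
  define L U where "L = Liminf (at x) (\<lambda>y. ereal (s y))" and "U = Limsup (at x) (\<lambda>y. ereal (s y))"
  have freq: "\<exists>y. y \<noteq> x \<and> \<bar>y - x\<bar> < e \<and> R (s y)" if "frequently (\<lambda>y. R (s y)) (at x)" "e > 0" for R e
    using that unfolding frequently_at by (auto simp: dist_real_def)
  have "L \<le> U" unfolding L_def U_def by (rule Liminf_le_Limsup) simp
  moreover have "\<not> L < U"
  proof
    assume "L < U"
    obtain q :: real where q: "q \<in> \<rat>" "L < ereal q" "ereal q < U"
      using ereal_dense3 [OF \<open>L < U\<close>] by (metis Rats_of_rat)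
    obtain p :: real where p: "p \<in> \<rat>" "L < ereal p" "p < q"
      using ereal_dense3 [OF q(2)] by (metis Rats_of_rat less_ereal.simps(1))
    have "frequently (\<lambda>y. s y < p) (at x)"
    proof (rule ccontr)
      assume "\<not> frequently (\<lambda>y. s y < p) (at x)"
      then have "eventually (\<lambda>y. ereal p \<le> ereal (s y)) (at x)" by (simp add: frequently_def not_less)
      then have "ereal p \<le> L" unfolding L_def by (rule Liminf_bounded)
      with p(2) show False by simp
    qed
    moreover have "frequently (\<lambda>y. q < s y) (at x)"
    proof (rule ccontr)
      assume "\<not> frequently (\<lambda>y. q < s y) (at x)"
      then have "eventually (\<lambda>y. ereal (s y) \<le> ereal q) (at x)" by (simp add: frequently_def not_less)
      then have "U \<le> ereal q" unfolding U_def by (rule Limsup_bounded)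
      with q(3) show False by simp
    qed
    ultimately show False
      using osc [OF p(1) q(1) p(3)] freq [of "\<lambda>t. t < p"] freq [of "\<lambda>t. q < t"] unfolding s_def by blast
  qed
  ultimately have "L = U" by simp
  then have lim: "((\<lambda>y. ereal (s y)) \<longlongrightarrow> U) (at x)"
    by (intro Liminf_eq_Limsup) (auto simp: L_def U_def)
  obtain M e where "e > 0" and M: "\<And>y. \<lbrakk>y \<noteq> x; \<bar>y - x\<bar> < e\<rbrakk> \<Longrightarrow> \<bar>f y - f x\<bar> \<le> M * \<bar>y - x\<bar>"
    using bounded by (metis not_le)
  have sM: "eventually (\<lambda>y. \<bar>s y\<bar> \<le> M) (at x)"
    unfolding eventually_at using \<open>e > 0\<close> M by (auto intro!: exI [of _ e] simp: s_def dist_real_def abs_divide divide_le_eq)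
  have "U \<le> ereal M"
    using sM by (intro tendsto_upperbound [OF lim]) (auto elim: eventually_mono)
  moreover have "ereal (- M) \<le> U"
    using sM by (intro tendsto_lowerbound [OF lim]) (auto elim: eventually_mono)
  ultimately obtain l where "U = ereal l" by (cases U) auto
  then have "(s \<longlongrightarrow> l) (at x)" using lim by simp
  then have "(f has_real_derivative l) (at x)"
    unfolding has_field_derivative_iff s_def .
  then show ?thesis using real_differentiable_def by blast
qed

text \<open>A point without derivative has unbounded slopes or slopes oscillating across some pair
  of rationals, which places it in a countable union of null sets.\<close>

theorem bounded_variation_negligible_nondifferentiable:
  assumes bv: "\<And>D. D division_of {c..d} \<Longrightarrow> (\<Sum>J\<in>D. \<bar>increment f J\<bar>) \<le> B"
  shows "negligible {x\<in>{c<..<d}. \<not> f differentiable at x}"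
proof (cases "c < d")
  case True
  let ?osc = "\<lambda>p q. {x\<in>{c<..<d}. \<forall>e>0.
           (\<exists>y. y \<noteq> x \<and> \<bar>y - x\<bar> < e \<and> (f y - f x) / (y - x) < p) \<and>
           (\<exists>y. y \<noteq> x \<and> \<bar>y - x\<bar> < e \<and> q < (f y - f x) / (y - x))}"
  have osc: "negligible (?osc p q)" if "p < q" for p q
  proof -
    \<comment> \<open>Subtracting a linear function of slope \<open>m\<close> shifts all slopes by
      the midpoint of \<open>p\<close> and \<open>q\<close>, making the thresholds symmetric about
      0. The variation grows by at most \<open>\<bar>m\<bar> * (d - c)\<close>.\<close>
    define m where "m = (p + q) / 2"
    define g where "g x = f x - m * x" for x
    have "(\<Sum>J\<in>D. \<bar>increment g J\<bar>) \<le> B + \<bar>m\<bar> * (d - c)" if D: "D division_of {c..d}" for D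
    proof -
      have "\<bar>increment g J\<bar> \<le> \<bar>increment f J\<bar> + \<bar>m\<bar> * content J" if "J \<in> D" for J
      proof -
        obtain u v where "J = {u..v}" "u \<le> v" using division_of_real_memberE [OF D \<open>J \<in> D\<close>] by metis
        moreover have "\<bar>m\<bar> * (v - u) = \<bar>m * (v - u)\<bar>" using \<open>u \<le> v\<close> by (simp add: abs_mult)
        ultimately show ?thesis by (simp add: g_def algebra_simps)
      qed
      then have "(\<Sum>J\<in>D. \<bar>increment g J\<bar>) \<le> (\<Sum>J\<in>D. \<bar>increment f J\<bar>) + \<bar>m\<bar> * sum content D"
        by (simp add: sum_distrib_left sum.distrib [symmetric] sum_mono)
      then show ?thesis
        using bv [OF D] additive_content_division [of D c d] D True by simp
    qed
    then have "negligible {x\<in>{c<..<d}. \<forall>e>0.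
           (\<exists>y. y \<noteq> x \<and> \<bar>y - x\<bar> < e \<and> (g y - g x) / (y - x) < - ((q - p) / 2)) \<and>
           (\<exists>y. y \<noteq> x \<and> \<bar>y - x\<bar> < e \<and> (q - p) / 2 < (g y - g x) / (y - x))}"
      using that by (intro negligible_oscillating_slopes) auto
    moreover have slope: "(g y - g x) / (y - x) = (f y - f x) / (y - x) - m" if "y \<noteq> x" for x y
    proof -
      have "g y - g x = (f y - f x) - m * (y - x)" by (simp add: g_def algebra_simps)
      then show ?thesis using that by (simp add: diff_divide_distrib)
    qed
    have thr: "t - m < - ((q - p) / 2) \<longleftrightarrow> t < p" "(q - p) / 2 < t - m \<longleftrightarrow> q < t" for t
      by (auto simp: m_def field_simps)
    have "(g y - g x) / (y - x) < - ((q - p) / 2) \<longleftrightarrow> (f y - f x) / (y - x) < p"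
      "(q - p) / 2 < (g y - g x) / (y - x) \<longleftrightarrow> q < (f y - f x) / (y - x)" if "y \<noteq> x" for x y
      unfolding slope [OF that] thr by (rule refl)+
    then have "y \<noteq> x \<and> \<bar>y - x\<bar> < e \<and> (g y - g x) / (y - x) < - ((q - p) / 2)
         \<longleftrightarrow> y \<noteq> x \<and> \<bar>y - x\<bar> < e \<and> (f y - f x) / (y - x) < p"
      "y \<noteq> x \<and> \<bar>y - x\<bar> < e \<and> (q - p) / 2 < (g y - g x) / (y - x)
         \<longleftrightarrow> y \<noteq> x \<and> \<bar>y - x\<bar> < e \<and> q < (f y - f x) / (y - x)" for x y e
      by blast+
    ultimately show ?thesis by (simp only:)
  qed
  let ?unb = "{x\<in>{c<..<d}. \<forall>M. \<forall>e>0. \<exists>y. y \<noteq> x \<and> \<bar>y - x\<bar> < e \<and> M * \<bar>y - x\<bar> < \<bar>f y - f x\<bar>}"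
  have "countable {(p, q). p \<in> \<rat> \<and> q \<in> (\<rat>::real set) \<and> p < q}"
    by (rule countable_subset [of _ "\<rat> \<times> \<rat>"]) (auto simp: countable_rat)
  then have "negligible (\<Union>(p, q)\<in>{(p, q). p \<in> \<rat> \<and> q \<in> \<rat> \<and> p < q}. ?osc p q)"
    using osc by (intro negligible_countable_Union) auto
  then have "negligible (?unb \<union> (\<Union>(p, q)\<in>{(p, q). p \<in> \<rat> \<and> q \<in> \<rat> \<and> p < q}. ?osc p q))"
    using negligible_unbounded_slopes [OF bv] by (rule negligible_Un [rotated])
  then show ?thesis
  proof (rule negligible_subset, intro subsetI)
    fix x assume x: "x \<in> {x\<in>{c<..<d}. \<not> f differentiable at x}"
    show "x \<in> ?unb \<union> (\<Union>(p, q)\<in>{(p, q). p \<in> \<rat> \<and> q \<in> \<rat> \<and> p < q}. ?osc p q)"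
    proof (rule ccontr)
      assume no: "x \<notin> ?unb \<union> (\<Union>(p, q)\<in>{(p, q). p \<in> \<rat> \<and> q \<in> \<rat> \<and> p < q}. ?osc p q)"
      have "f differentiable at x"
      proof (rule differentiable_from_slopes)
        show "\<not> (\<forall>M. \<forall>e>0. \<exists>y. y \<noteq> x \<and> \<bar>y - x\<bar> < e \<and> M * \<bar>y - x\<bar> < \<bar>f y - f x\<bar>)"
          using no x by blast
        fix p q :: real assume "p \<in> \<rat>" "q \<in> \<rat>" "p < q"
        then have "x \<notin> ?osc p q" using no by blast
        then show "\<not> (\<forall>e>0. (\<exists>y. y \<noteq> x \<and> \<bar>y - x\<bar> < e \<and> (f y - f x) / (y - x) < p) \<and>
           (\<exists>y. y \<noteq> x \<and> \<bar>y - x\<bar> < e \<and> q < (f y - f x) / (y - x)))"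
          using x by blast
      qed
      with x show False by blast
    qed
  qed
qed simp

text \<open>On an interval shorter than the \<delta> belonging to \<epsilon> = 1 the variation is at
  most 1, so the bounded variation case applies near each point; negligibility is a local
  property.\<close>

theorem abs_cont_negligible_nondifferentiable:
  assumes "abs_cont_on_interval a b f"
  shows "negligible {x\<in>{a<..<b}. \<not> f differentiable at x}"
    (is "negligible ?E")
proof -
  obtain \<delta> where "\<delta> > 0" and \<delta>: "\<And>D. \<lbrakk>D division_of \<Union>D; \<Union>D \<subseteq> {a..b}; sum content D < \<delta>\<rbrakk>
      \<Longrightarrow> (\<Sum>J\<in>D. \<bar>increment f J\<bar>) < 1"
    using abs_cont_division [OF assms zero_less_one] by blast
  have "\<exists>U. openin (top_of_set ?E) U \<and> x \<in> U \<and> negligible U" if x: "x \<in> ?E" for x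
  proof -
    \<comment> \<open>A third of \<delta> on each side keeps the length below \<delta>;
      \<open>max\<close> and \<open>min\<close> keep the neighbourhood inside
      \<open>{a..b}\<close>.\<close>
    define c d where "c = max a (x - \<delta> / 3)" and "d = min b (x + \<delta> / 3)"
    have cd: "c < x" "x < d" "{c..d} \<subseteq> {a..b}" "d - c < \<delta>"
      using x \<open>\<delta> > 0\<close> by (auto simp: c_def d_def)
    have "negligible {x\<in>{c<..<d}. \<not> f differentiable at x}"
    proof (rule bounded_variation_negligible_nondifferentiable)
      fix D assume D: "D division_of {c..d}"
      have "\<Union>D = {c..d}" using D by (rule division_ofD(6))
      moreover have "sum content D < \<delta>"
        using additive_content_division [of D c d] D cd by simp
      ultimately show "(\<Sum>J\<in>D. \<bar>increment f J\<bar>) \<le> 1"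
        using \<delta> [of D] D cd(3) by simp
    qed
    then have "negligible (?E \<inter> {c<..<d})"
      by (rule negligible_subset) auto
    moreover have "openin (top_of_set ?E) (?E \<inter> {c<..<d})" by (rule openin_open_Int) simp
    ultimately show ?thesis using x cd by (intro exI [of _ "?E \<inter> {c<..<d}"]) auto
  qed
  then show ?thesis by (subst locally_negligible_alt) blast
qed

section \<open>Products and quotients of absolutely continuous functions\<close>

lemma abs_cont_imp_continuous_on:
  assumes "abs_cont_on_interval a b f"
  shows "continuous_on {a..b} f"
  unfolding continuous_on_iff
proof (intro ballI allI impI)
  fix x and e :: real assume "x \<in> {a..b}" "e > 0"
  obtain \<delta> where "\<delta> > 0" and \<delta>: "\<And>D. \<lbrakk>D division_of \<Union>D; \<Union>D \<subseteq> {a..b}; sum content D < \<delta>\<rbrakk>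
      \<Longrightarrow> (\<Sum>J\<in>D. \<bar>increment f J\<bar>) < e"
    using abs_cont_division [OF assms \<open>e > 0\<close>] by blast
  have near: "\<bar>f v - f u\<bar> < e" if "u \<in> {a..b}" "v \<in> {a..b}" "u \<le> v" "v - u < \<delta>" for u v
  proof -
    have "{{u..v}} division_of {u..v}" using division_of_self [of u v] \<open>u \<le> v\<close> by simp
    then show ?thesis using \<delta> [of "{{u..v}}"] that by simp
  qed
  show "\<exists>d>0. \<forall>y\<in>{a..b}. dist y x < d \<longrightarrow> dist (f y) (f x) < e"
  proof (intro exI [of _ \<delta>] conjI ballI impI \<open>\<delta> > 0\<close>)
    fix y assume "y \<in> {a..b}" "dist y x < \<delta>"
    then show "dist (f y) (f x) < e"
      using near [of x y] near [of y x] \<open>x \<in> {a..b}\<close> by (cases "x \<le> y") (auto simp: dist_real_def)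
  qed
qed

text \<open>A Lipschitz second factor is all that is required, since it will be
  \<open>1 / \<psi>\<close> with \<psi> continuously differentiable and nonzero on a compact
  interval. Both factors are bounded there, and the product increment splits into one term for each
  factor.\<close>

lemma abs_cont_mult_lipschitz:
  fixes f g :: "real \<Rightarrow> real"
  assumes f: "abs_cont_on_interval a b f" and g: "C-lipschitz_on {a..b} g"
  shows "abs_cont_on_interval a b (\<lambda>x. f x * g x)"
proof -
  have "C \<ge> 0" using g by (rule lipschitz_on_nonneg)
  have bound: "\<exists>B\<ge>0. \<forall>x\<in>{a..b}. \<bar>h x\<bar> \<le> B" if "continuous_on {a..b} h" for h :: "real \<Rightarrow> real"
  proof -
    have "bounded (h ` {a..b})" using that by (intro compact_imp_bounded compact_continuous_image) auto
    then obtain B where "\<forall>x\<in>{a..b}. \<bar>h x\<bar> \<le> B" unfolding bounded_iff by auto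
    then show ?thesis by (intro exI [of _ "\<bar>B\<bar>"]) fastforce
  qed
  obtain B where "B \<ge> 0" and B: "\<And>x. x \<in> {a..b} \<Longrightarrow> \<bar>f x\<bar> \<le> B"
    using bound [OF abs_cont_imp_continuous_on [OF f]] by blast
  obtain M where "M \<ge> 0" and M: "\<And>x. x \<in> {a..b} \<Longrightarrow> \<bar>g x\<bar> \<le> M"
    using bound [OF lipschitz_on_continuous_on [OF g]] by blast
  show ?thesis
    unfolding abs_cont_on_interval_def
  proof (intro allI impI)
    fix \<epsilon> :: real assume "\<epsilon> > 0"
    \<comment> \<open>\<open>\<epsilon>1\<close> and \<open>\<delta>2\<close> assign half of
      \<epsilon> to each of the two terms. The added 1 covers \<open>M = 0\<close>, respectively
      \<open>B * C = 0\<close>.\<close>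
    define \<epsilon>1 where "\<epsilon>1 = \<epsilon> / (2 * (M + 1))"
    have "\<epsilon>1 > 0" using \<open>\<epsilon> > 0\<close> \<open>M \<ge> 0\<close> by (simp add: \<epsilon>1_def)
    then obtain \<delta>1 where "\<delta>1 > 0" and \<delta>1: "\<forall>(n::nat) (u::nat \<Rightarrow> real) v. (\<forall>i<n. a \<le> u i \<and> u i \<le> v i \<and> v i \<le> b) \<and>
        (\<forall>i<n. \<forall>j<n. i \<noteq> j \<longrightarrow> {u i<..<v i} \<inter> {u j<..<v j} = {}) \<and>
        (\<Sum>i<n. v i - u i) < \<delta>1 \<longrightarrow> (\<Sum>i<n. \<bar>f (v i) - f (u i)\<bar>) < \<epsilon>1"
      using f unfolding abs_cont_on_interval_def by blast
    define \<delta>2 where "\<delta>2 = \<epsilon> / (2 * (B * C + 1))"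
    have "B * C \<ge> 0" using \<open>B \<ge> 0\<close> \<open>C \<ge> 0\<close> by simp
    then have "\<delta>2 > 0" using \<open>\<epsilon> > 0\<close> by (simp add: \<delta>2_def)
    show "\<exists>\<delta>>0. \<forall>(n::nat) u v. (\<forall>i<n. a \<le> u i \<and> u i \<le> v i \<and> v i \<le> b) \<and>
        (\<forall>i<n. \<forall>j<n. i \<noteq> j \<longrightarrow> {u i<..<v i} \<inter> {u j<..<v j} = {}) \<and>
        (\<Sum>i<n. v i - u i) < \<delta> \<longrightarrow> (\<Sum>i<n. \<bar>f (v i) * g (v i) - f (u i) * g (u i)\<bar>) < \<epsilon>"
    proof (intro exI [of _ "min \<delta>1 \<delta>2"] conjI allI impI; (elim conjE)?)
      show "0 < min \<delta>1 \<delta>2" using \<open>\<delta>1 > 0\<close> \<open>\<delta>2 > 0\<close> by simp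
      fix n :: nat and u v :: "nat \<Rightarrow> real"
      assume uv: "\<forall>i<n. a \<le> u i \<and> u i \<le> v i \<and> v i \<le> b"
        and disj: "\<forall>i<n. \<forall>j<n. i \<noteq> j \<longrightarrow> {u i<..<v i} \<inter> {u j<..<v j} = {}"
        and small: "(\<Sum>i<n. v i - u i) < min \<delta>1 \<delta>2"
      have f1: "(\<Sum>i<n. \<bar>f (v i) - f (u i)\<bar>) < \<epsilon>1"
        using \<delta>1 [rule_format, of n u v] uv disj small by simp
      have "(\<Sum>i<n. \<bar>f (v i) * g (v i) - f (u i) * g (u i)\<bar>)
          \<le> (\<Sum>i<n. M * \<bar>f (v i) - f (u i)\<bar> + B * C * (v i - u i))"
      proof (rule sum_mono)
        fix i assume "i \<in> {..<n}"
        then have i: "u i \<in> {a..b}" "v i \<in> {a..b}" "u i \<le> v i" using uv by force+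
        have "\<bar>g (v i) - g (u i)\<bar> \<le> C * (v i - u i)"
          using lipschitz_onD [OF g i(2,1)] i(3) by (simp add: dist_real_def)
        then have "\<bar>f (u i)\<bar> * \<bar>g (v i) - g (u i)\<bar> \<le> B * (C * (v i - u i))"
          using B [OF i(1)] \<open>B \<ge> 0\<close> by (intro mult_mono) auto
        moreover have "\<bar>g (v i)\<bar> * \<bar>f (v i) - f (u i)\<bar> \<le> M * \<bar>f (v i) - f (u i)\<bar>"
          using M [OF i(2)] by (intro mult_right_mono) auto
        moreover have "f (v i) * g (v i) - f (u i) * g (u i)
            = g (v i) * (f (v i) - f (u i)) + f (u i) * (g (v i) - g (u i))"
          by (simp add: algebra_simps)
        ultimately show "\<bar>f (v i) * g (v i) - f (u i) * g (u i)\<bar>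
            \<le> M * \<bar>f (v i) - f (u i)\<bar> + B * C * (v i - u i)"
          using abs_triangle_ineq [of "g (v i) * (f (v i) - f (u i))" "f (u i) * (g (v i) - g (u i))"]
          by (simp add: abs_mult mult.assoc)
      qed
      also have "\<dots> = M * (\<Sum>i<n. \<bar>f (v i) - f (u i)\<bar>) + B * C * (\<Sum>i<n. v i - u i)"
        by (simp add: sum.distrib sum_distrib_left)
      also have "\<dots> \<le> M * \<epsilon>1 + B * C * \<delta>2"
        using f1 small \<open>M \<ge> 0\<close> \<open>B * C \<ge> 0\<close> by (intro add_mono mult_left_mono) auto
      also have "\<dots> < (M + 1) * \<epsilon>1 + (B * C + 1) * \<delta>2"
        using \<open>\<epsilon>1 > 0\<close> \<open>\<delta>2 > 0\<close> by (simp add: algebra_simps)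
      also have "\<dots> = \<epsilon>"
      proof -
        have "(M + 1) * \<epsilon>1 = \<epsilon> / 2" "(B * C + 1) * \<delta>2 = \<epsilon> / 2"
          using \<open>M \<ge> 0\<close> \<open>B * C \<ge> 0\<close> by (simp_all add: \<epsilon>1_def \<delta>2_def divide_simps)
        then show ?thesis by simp
      qed
      finally show "(\<Sum>i<n. \<bar>f (v i) * g (v i) - f (u i) * g (u i)\<bar>) < \<epsilon>" .
    qed
  qed
qed

text \<open>The integrand is the quotient rule with \<open>deriv f\<close>, which is a genuine
  derivative only off a null set. The quotient \<open>f / \<psi>\<close> is absolutely continuous
  because \<open>1 / \<psi>\<close> has a bounded derivative and is therefore Lipschitz.\<close>

lemma has_integral_deriv_quotient:
  fixes f \<psi> d\<psi> :: "real \<Rightarrow> real"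
  assumes f: "abs_cont_on_interval a b f" and "a \<le> b"
    and \<psi>: "\<And>t. t \<in> {a..b} \<Longrightarrow> (\<psi> has_real_derivative d\<psi> t) (at t within {a..b})"
    and c: "continuous_on {a..b} d\<psi>" and nz: "\<And>t. t \<in> {a..b} \<Longrightarrow> \<psi> t \<noteq> 0"
  shows "((\<lambda>t. (deriv f t * \<psi> t - f t * d\<psi> t) / (\<psi> t)\<^sup>2) has_integral f b / \<psi> b - f a / \<psi> a) {a..b}"
proof -
  have c\<psi>: "continuous_on {a..b} \<psi>"
    using \<psi> by (meson DERIV_continuous continuous_on_eq_continuous_within)
  have d: "((\<lambda>t. 1 / \<psi> t) has_real_derivative - d\<psi> t / (\<psi> t)\<^sup>2) (at t within {a..b})" if "t \<in> {a..b}" for t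
    using nz [OF that] by (auto intro!: derivative_eq_intros \<psi> [OF that] simp: power2_eq_square)
  have "continuous_on {a..b} (\<lambda>t. - d\<psi> t / (\<psi> t)\<^sup>2)"
    using nz by (intro continuous_intros c c\<psi>) auto
  then have "bounded ((\<lambda>t. - d\<psi> t / (\<psi> t)\<^sup>2) ` {a..b})"
    by (intro compact_imp_bounded compact_continuous_image) auto
  then obtain C where "C > 0" and C: "\<And>t. t \<in> {a..b} \<Longrightarrow> norm (- d\<psi> t / (\<psi> t)\<^sup>2) \<le> C"
    unfolding bounded_pos by auto
  have "C-lipschitz_on {a..b} (\<lambda>t. 1 / \<psi> t)"
  proof (rule lipschitz_onI)
    show "dist (1 / \<psi> x) (1 / \<psi> y) \<le> C * dist x y" if "x \<in> {a..b}" "y \<in> {a..b}" for x y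
      using field_differentiable_bound [OF convex_real_interval(5) d C that]
      by (simp add: dist_real_def)
  qed (use \<open>C > 0\<close> in simp)
  then have ac: "abs_cont_on_interval a b (\<lambda>t. f t * (1 / \<psi> t))"
    by (rule abs_cont_mult_lipschitz [OF f])
  \<comment> \<open>The endpoints are included because differentiability almost everywhere was
    obtained in the open interval only.\<close>
  define N where "N = {t\<in>{a<..<b}. \<not> f differentiable at t} \<union> {a, b}"
  have "negligible N"
    using abs_cont_negligible_nondifferentiable [OF f] by (simp add: N_def negligible_Un)
  have "((\<lambda>t. (deriv f t * \<psi> t - f t * d\<psi> t) / (\<psi> t)\<^sup>2) has_integral
          f b * (1 / \<psi> b) - f a * (1 / \<psi> a)) {a..b}"
  proof (rule abs_cont_has_integral [OF ac \<open>a \<le> b\<close> \<open>negligible N\<close>])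
    fix t assume t: "t \<in> {a..b} - N"
    then have "f differentiable at t" by (auto simp: N_def)
    then have "(f has_real_derivative deriv f t) (at t within {a..b})"
      using DERIV_deriv_iff_real_differentiable DERIV_subset by blast
    then show "((\<lambda>t. f t * (1 / \<psi> t)) has_real_derivative (deriv f t * \<psi> t - f t * d\<psi> t) / (\<psi> t)\<^sup>2)
        (at t within {a..b})"
      using DERIV_divide [of f "deriv f t" t "{a..b}" \<psi> "d\<psi> t"] \<psi> [of t] nz [of t] t
      by (simp add: power2_eq_square)
  qed
  then show ?thesis by simp
qed

section \<open>Two-term asymptotic expansions\<close>

lemma eventually_lim_filter:
  assumes "ereal S < x0"
  shows "eventually (\<lambda>y. S < y \<and> ereal y < x0) (lim_filter x0)"
proof (cases x0)
  case (real r)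
  with assms have "eventually (\<lambda>y. y \<in> {S<..<r}) (at_left r)"
    by (intro eventually_at_left_real) simp
  then show ?thesis using real by (simp add: lim_filter_def)
next
  case PInf
  then show ?thesis by (simp add: lim_filter_def eventually_gt_at_top)
next
  case MInf
  with assms show ?thesis by simp
qed

lemma lim_filter_neq_bot: "lim_filter x0 \<noteq> bot"
  by (simp add: lim_filter_def)

text \<open>The partial integrals are \<open>h y - h x\<close>, so convergence means that
  \<open>h\<close> has a limit. This criterion does not mention the lower endpoint, so convergence
  from one starting point gives it from any other at which the hypotheses hold.\<close>

lemma improper_int_primitive:
  assumes g: "\<And>y. \<lbrakk>x \<le> y; ereal y < x0\<rbrakk> \<Longrightarrow> (g has_integral h y - h x) {x..y}" and x: "ereal x < x0"
  shows "improper_conv g x x0 \<longleftrightarrow> (\<exists>L. (h \<longlongrightarrow> L) (lim_filter x0))"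
    and "(h \<longlongrightarrow> L) (lim_filter x0) \<Longrightarrow> improper_int g x x0 = L - h x"
proof -
  have ev: "eventually (\<lambda>y. integral {x..y} g = h y - h x) (lim_filter x0)"
    using eventually_lim_filter [OF x] by eventually_elim (auto intro!: integral_unique g)
  have lim: "((\<lambda>y. integral {x..y} g) \<longlongrightarrow> L) (lim_filter x0) \<longleftrightarrow> ((\<lambda>y. h y - h x) \<longlongrightarrow> L) (lim_filter x0)" for L
    by (rule tendsto_cong [OF ev])
  have shift: "((\<lambda>y. h y - h x) \<longlongrightarrow> L) (lim_filter x0) \<longleftrightarrow> (h \<longlongrightarrow> L + h x) (lim_filter x0)" for L
    using tendsto_diff [of h "L + h x" "lim_filter x0" "\<lambda>_. h x" "h x"]
      tendsto_add [of "\<lambda>y. h y - h x" L "lim_filter x0" "\<lambda>_. h x" "h x"] by auto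
  have "(\<exists>L. (h \<longlongrightarrow> L + h x) (lim_filter x0)) \<longleftrightarrow> (\<exists>L. (h \<longlongrightarrow> L) (lim_filter x0))"
    by (metis diff_add_cancel)
  then show "improper_conv g x x0 \<longleftrightarrow> (\<exists>L. (h \<longlongrightarrow> L) (lim_filter x0))"
    unfolding improper_conv_def lim shift using g has_integral_integrable by blast
  show "improper_int g x x0 = L - h x" if "(h \<longlongrightarrow> L) (lim_filter x0)"
    unfolding improper_int_def using that
    by (intro tendsto_Lim lim_filter_neq_bot) (simp add: lim shift)
qed

text \<open>Dividing the remainder by \<phi> gives
  \<open>- (\<psi> / \<phi> * (b1 - f / \<psi>) + b2)\<close>, and the remainder is of smaller order
  exactly when this tends to 0.\<close>

lemma smallo_expansion_iff:
  fixes f \<psi> \<phi> :: "real \<Rightarrow> real"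
  assumes nz: "eventually (\<lambda>x. \<psi> x \<noteq> 0 \<and> \<phi> x \<noteq> 0) F"
  shows "(\<lambda>x. f x - b1 * \<psi> x - b2 * \<phi> x) \<in> o[F](\<phi>)
     \<longleftrightarrow> ((\<lambda>x. \<psi> x / \<phi> x * (b1 - f x / \<psi> x)) \<longlongrightarrow> - b2) F"
proof -
  have ev: "eventually (\<lambda>x. \<phi> x \<noteq> 0) F" using nz by eventually_elim simp
  have "(\<lambda>x. f x - b1 * \<psi> x - b2 * \<phi> x) \<in> o[F](\<phi>)
      \<longleftrightarrow> ((\<lambda>x. (f x - b1 * \<psi> x - b2 * \<phi> x) / \<phi> x) \<longlongrightarrow> 0) F"
    by (rule iffI [OF smalloD_tendsto smalloI_tendsto [OF _ ev]])
  also have "\<dots> \<longleftrightarrow> ((\<lambda>x. - (\<psi> x / \<phi> x * (b1 - f x / \<psi> x) - - b2)) \<longlongrightarrow> 0) F"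
  proof (rule tendsto_cong)
    show "eventually (\<lambda>x. (f x - b1 * \<psi> x - b2 * \<phi> x) / \<phi> x
        = - (\<psi> x / \<phi> x * (b1 - f x / \<psi> x) - - b2)) F"
      using nz by eventually_elim (simp add: field_simps)
  qed
  also have "\<dots> \<longleftrightarrow> ((\<lambda>x. \<psi> x / \<phi> x * (b1 - f x / \<psi> x) - - b2) \<longlongrightarrow> 0) F"
    by (rule tendsto_minus_cancel_left [where y = "0::real", unfolded minus_zero, symmetric])
  also have "\<dots> \<longleftrightarrow> ((\<lambda>x. \<psi> x / \<phi> x * (b1 - f x / \<psi> x)) \<longlongrightarrow> - b2) F"
    by (rule Lim_null [symmetric])
  finally show ?thesis .
qed

text \<open>The theorem uses \<open>\<phi>1\<close> on \<open>[T, x0)\<close> as well as \<open>\<Phi>\<close>, which vanishes at \<open>T\<close>, on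
  \<open>(T, x0)\<close> in the role of \<open>\<psi>\<close>; hence the arbitrary interval \<open>J\<close> with right end point \<open>x0\<close>.\<close>

locale asymptotic_pair =
  fixes x0 :: ereal and J :: "real set" and \<psi> d\<psi> \<phi> d\<phi> f :: "real \<Rightarrow> real"
  assumes J: "J \<noteq> {}" "\<And>x. x \<in> J \<Longrightarrow> ereal x < x0"
      "\<And>x y. \<lbrakk>x \<in> J; x \<le> y; ereal y < x0\<rbrakk> \<Longrightarrow> y \<in> J"
    and \<psi>: "\<And>x. x \<in> J \<Longrightarrow> (\<psi> has_real_derivative d\<psi> x) (at x within J)"
    and \<phi>: "\<And>x. x \<in> J \<Longrightarrow> (\<phi> has_real_derivative d\<phi> x) (at x within J)"
    and c\<psi>: "continuous_on J d\<psi>"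
    and small: "\<phi> \<in> o[lim_filter x0](\<psi>)"
    and nz: "\<And>x. x \<in> J \<Longrightarrow> \<psi> x \<noteq> 0" "\<And>x. x \<in> J \<Longrightarrow> \<phi> x \<noteq> 0"
      "\<And>x. x \<in> J \<Longrightarrow> Wr \<psi> d\<psi> \<phi> d\<phi> x \<noteq> 0"
    and f: "\<And>a b. \<lbrakk>a \<in> J; a \<le> b; ereal b < x0\<rbrakk> \<Longrightarrow> abs_cont_on_interval a b f"
begin

theorem two_term_expansion:
  defines "F \<equiv> lim_filter x0"
    and "W \<equiv> Wr \<psi> d\<psi> \<phi> d\<phi>"
    and "fs \<equiv> (\<lambda>t. - Wr f (deriv f) \<psi> d\<psi> t / Wr \<psi> d\<psi> \<phi> d\<phi> t)"
  shows "(\<exists>b1 b2. (\<lambda>x. f x - b1 * \<psi> x - b2 * \<phi> x) \<in> o[F](\<phi>)) \<longleftrightarrow>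
      (\<forall>x\<in>J. improper_conv (\<lambda>t. W t / (\<psi> t)\<^sup>2 * fs t) x x0) \<and>
      (\<exists>L. ((\<lambda>x. \<psi> x / \<phi> x * improper_int (\<lambda>t. W t / (\<psi> t)\<^sup>2 * fs t) x x0) \<longlongrightarrow> L) F)"
    (is "?exp \<longleftrightarrow> ?conv")
    and "\<And>b1 b2 m x. \<lbrakk>(\<lambda>x. f x - b1 * \<psi> x - b2 * \<phi> x) \<in> o[F](\<phi>);
        ((\<lambda>x. \<psi> x / \<phi> x * improper_int (\<lambda>t. W t / (\<psi> t)\<^sup>2 * fs t) x x0) \<longlongrightarrow> - m) F; x \<in> J\<rbrakk>
      \<Longrightarrow> improper_conv (\<lambda>t. W t / (\<psi> t)\<^sup>2 * (fs t - m)) x x0 \<and>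
          f x = b1 * \<psi> x + b2 * \<phi> x - \<psi> x * improper_int (\<lambda>t. W t / (\<psi> t)\<^sup>2 * (fs t - m)) x x0"
proof -
  define h r where "h x = f x / \<psi> x" and "r x = \<phi> x / \<psi> x" for x
  have J_Icc: "{x..y} \<subseteq> J" if "x \<in> J" "ereal y < x0" for x y
  proof
    fix t assume t: "t \<in> {x..y}"
    then have "ereal t < x0" using that(2) by (intro le_less_trans [of "ereal t" "ereal y"]) auto
    then show "t \<in> J" using J(3) [OF that(1)] t by simp
  qed
  obtain S where "S \<in> J" using J(1) by blast
  have evJ: "eventually (\<lambda>x. x \<in> J) F"
    unfolding F_def using eventually_lim_filter [OF J(2) [OF \<open>S \<in> J\<close>]]
    by eventually_elim (use J(3) \<open>S \<in> J\<close> in auto)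
  then have evnz: "eventually (\<lambda>x. \<psi> x \<noteq> 0 \<and> \<phi> x \<noteq> 0) F"
    by eventually_elim (simp add: nz)
  have F: "F \<noteq> bot" by (simp add: F_def lim_filter_neq_bot)
  have r0: "(r \<longlongrightarrow> 0) F" unfolding r_def using smalloD_tendsto [OF small] by (simp add: F_def)
  \<comment> \<open>The Wronskian cancels, leaving the formal derivative of
    \<open>f / \<psi>\<close>.\<close>
  have kernel: "W t / (\<psi> t)\<^sup>2 * fs t = (deriv f t * \<psi> t - f t * d\<psi> t) / (\<psi> t)\<^sup>2" if "t \<in> J" for t
  proof -
    have "W t * fs t = - Wr f (deriv f) \<psi> d\<psi> t"
      using nz(3) [OF that] by (simp add: W_def fs_def)
    also have "\<dots> = deriv f t * \<psi> t - f t * d\<psi> t" by (simp add: Wr_def)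
    finally show ?thesis by simp
  qed
  have hint: "((\<lambda>t. W t / (\<psi> t)\<^sup>2 * fs t) has_integral h y - h x) {x..y}"
    if "x \<in> J" "x \<le> y" "ereal y < x0" for x y
  proof -
    have sub: "{x..y} \<subseteq> J" using J_Icc that by blast
    have "((\<lambda>t. (deriv f t * \<psi> t - f t * d\<psi> t) / (\<psi> t)\<^sup>2) has_integral f y / \<psi> y - f x / \<psi> x) {x..y}"
    proof (rule has_integral_deriv_quotient [OF f [OF that] that(2)])
      show "(\<psi> has_real_derivative d\<psi> t) (at t within {x..y})" if "t \<in> {x..y}" for t
        using DERIV_subset [OF \<psi> sub] sub that by blast
      show "continuous_on {x..y} d\<psi>" using c\<psi> sub by (rule continuous_on_subset)
      show "\<psi> t \<noteq> 0" if "t \<in> {x..y}" for t using nz(1) sub that by blast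
    qed
    then show ?thesis
      unfolding h_def by (rule has_integral_eq [rotated]) (rule kernel [symmetric, OF subsetD [OF sub]])
  qed
  have rint: "((\<lambda>t. W t / (\<psi> t)\<^sup>2) has_integral r y - r x) {x..y}"
    if "x \<in> J" "x \<le> y" "ereal y < x0" for x y
  proof (rule fundamental_theorem_of_calculus [OF that(2)])
    fix t assume "t \<in> {x..y}"
    then have "t \<in> J" and sub: "{x..y} \<subseteq> J" using J_Icc that by blast+
    have "(r has_real_derivative (d\<phi> t * \<psi> t - \<phi> t * d\<psi> t) / (\<psi> t * \<psi> t)) (at t within {x..y})"
      unfolding r_def
      using \<phi> [OF \<open>t \<in> J\<close>] \<psi> [OF \<open>t \<in> J\<close>] sub nz(1) [OF \<open>t \<in> J\<close>] by (intro DERIV_divide) (auto intro: DERIV_subset)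
    then show "(r has_vector_derivative W t / (\<psi> t)\<^sup>2) (at t within {x..y})"
      by (simp add: has_real_derivative_iff_has_vector_derivative [symmetric] W_def Wr_def power2_eq_square algebra_simps)
  qed
  have conv: "improper_conv (\<lambda>t. W t / (\<psi> t)\<^sup>2 * fs t) x x0 \<longleftrightarrow> (\<exists>L. (h \<longlongrightarrow> L) F)"
    and int: "(h \<longlongrightarrow> L) F \<Longrightarrow> improper_int (\<lambda>t. W t / (\<psi> t)\<^sup>2 * fs t) x x0 = L - h x"
    if "x \<in> J" for x L
    using improper_int_primitive [OF hint [OF that] J(2) [OF that]] unfolding F_def by blast+
  have ev_int: "eventually (\<lambda>x. \<psi> x / \<phi> x * improper_int (\<lambda>t. W t / (\<psi> t)\<^sup>2 * fs t) x x0
       = \<psi> x / \<phi> x * (L - f x / \<psi> x)) F" if "(h \<longlongrightarrow> L) F" for L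
    using evJ by eventually_elim (simp only: int [OF _ that] h_def)
  have exp_lim: "(h \<longlongrightarrow> b1) F"
    and exp_int: "((\<lambda>x. \<psi> x / \<phi> x * improper_int (\<lambda>t. W t / (\<psi> t)\<^sup>2 * fs t) x x0) \<longlongrightarrow> - b2) F"
    if "(\<lambda>x. f x - b1 * \<psi> x - b2 * \<phi> x) \<in> o[F](\<phi>)" for b1 b2
  proof -
    have lim: "((\<lambda>x. \<psi> x / \<phi> x * (b1 - f x / \<psi> x)) \<longlongrightarrow> - b2) F"
      using that smallo_expansion_iff [OF evnz] by blast
    \<comment> \<open>Multiplying by \<open>r\<close>, which tends to 0, removes the factor
      \<open>\<psi> / \<phi>\<close>; so the expansion forces \<open>h\<close> to converge to
      \<open>b1\<close>, and the improper integrals exist.\<close>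
    have "((\<lambda>x. r x * (\<psi> x / \<phi> x * (b1 - f x / \<psi> x))) \<longlongrightarrow> 0 * - b2) F"
      by (intro tendsto_mult r0 lim)
    moreover have "eventually (\<lambda>x. r x * (\<psi> x / \<phi> x * (b1 - f x / \<psi> x)) = b1 - h x) F"
      using evnz by eventually_elim (simp add: r_def h_def)
    ultimately have "((\<lambda>x. b1 - h x) \<longlongrightarrow> 0) F"
      using tendsto_cong by fastforce
    then have "((\<lambda>x. b1 - (b1 - h x)) \<longlongrightarrow> b1 - 0) F" by (intro tendsto_intros)
    then show "(h \<longlongrightarrow> b1) F" by simp
    then show "((\<lambda>x. \<psi> x / \<phi> x * improper_int (\<lambda>t. W t / (\<psi> t)\<^sup>2 * fs t) x x0) \<longlongrightarrow> - b2) F"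
      using tendsto_cong [OF ev_int] lim by blast
  qed
  show "?exp \<longleftrightarrow> ?conv"
  proof
    assume ?exp
    then obtain b1 b2 where "(\<lambda>x. f x - b1 * \<psi> x - b2 * \<phi> x) \<in> o[F](\<phi>)" by blast
    from exp_lim [OF this] exp_int [OF this] show ?conv using conv by blast
  next
    assume ?conv
    \<comment> \<open>Convergence of the integral from the single point \<open>S\<close> already
      yields the limit \<open>b1\<close> of \<open>h\<close>; the second coefficient is then
      \<open>- L\<close>.\<close>
    then obtain b1 L where b1: "(h \<longlongrightarrow> b1) F"
      and L: "((\<lambda>x. \<psi> x / \<phi> x * improper_int (\<lambda>t. W t / (\<psi> t)\<^sup>2 * fs t) x x0) \<longlongrightarrow> L) F"
      using conv \<open>S \<in> J\<close> by blast
    have "((\<lambda>x. \<psi> x / \<phi> x * (b1 - f x / \<psi> x)) \<longlongrightarrow> - (- L)) F"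
      using tendsto_cong [OF ev_int [OF b1]] L by simp
    then show ?exp using smallo_expansion_iff [OF evnz] by blast
  qed
  fix b1 b2 m x
  assume exp: "(\<lambda>x. f x - b1 * \<psi> x - b2 * \<phi> x) \<in> o[F](\<phi>)"
    and m: "((\<lambda>x. \<psi> x / \<phi> x * improper_int (\<lambda>t. W t / (\<psi> t)\<^sup>2 * fs t) x x0) \<longlongrightarrow> - m) F"
    and "x \<in> J"
  have "m = b2" using tendsto_unique [OF F m exp_int [OF exp]] by simp
  \<comment> \<open>A primitive of the kernel with \<open>m\<close> subtracted. Since
    \<open>r\<close> tends to 0, it has the same limit \<open>b1\<close> as \<open>h\<close>, and
    solving \<open>improper_int = b1 - q x\<close> for \<open>f x\<close> is the representation
    formula.\<close>
  define q where "q y = h y - m * r y" for y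
  have "((\<lambda>t. W t / (\<psi> t)\<^sup>2 * (fs t - m)) has_integral q y - q x) {x..y}"
    if "x \<le> y" "ereal y < x0" for y
  proof -
    have "((\<lambda>t. W t / (\<psi> t)\<^sup>2 * fs t - m * (W t / (\<psi> t)\<^sup>2)) has_integral
        (h y - h x) - m * (r y - r x)) {x..y}"
      using hint [OF \<open>x \<in> J\<close> that] rint [OF \<open>x \<in> J\<close> that]
      by (intro has_integral_diff has_integral_mult_right)
    moreover have "W t / (\<psi> t)\<^sup>2 * fs t - m * (W t / (\<psi> t)\<^sup>2) = W t / (\<psi> t)\<^sup>2 * (fs t - m)" for t
    proof -
      have "a * b - c * a = a * (b - c)" for a b c :: real by (simp add: algebra_simps)
      then show ?thesis .
    qed
    moreover have "(h y - h x) - m * (r y - r x) = q y - q x"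
      by (simp add: q_def algebra_simps)
    ultimately show ?thesis by (simp only:)
  qed
  note prim = improper_int_primitive [OF this J(2) [OF \<open>x \<in> J\<close>]]
  have "(q \<longlongrightarrow> b1 - m * 0) F"
    unfolding q_def by (intro tendsto_intros exp_lim [OF exp] r0)
  then have q: "(q \<longlongrightarrow> b1) (lim_filter x0)" by (simp add: F_def)
  have "improper_int (\<lambda>t. W t / (\<psi> t)\<^sup>2 * (fs t - m)) x x0 = b1 - q x"
    using prim(2) q by blast
  moreover have "\<psi> x * q x = f x - b2 * \<phi> x"
    using nz(1) [OF \<open>x \<in> J\<close>] by (simp add: q_def h_def r_def \<open>m = b2\<close> field_simps)
  ultimately show "improper_conv (\<lambda>t. W t / (\<psi> t)\<^sup>2 * (fs t - m)) x x0 \<and>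
      f x = b1 * \<psi> x + b2 * \<phi> x - \<psi> x * improper_int (\<lambda>t. W t / (\<psi> t)\<^sup>2 * (fs t - m)) x x0"
    using prim(1) q by (auto simp: algebra_simps)
qed

end

section \<open>Application to the pairs (\<open>phi1\<close>, \<open>phi2\<close>) and
  (\<open>Phi\<close>, \<open>phi2\<close>)\<close>

theorem theorem4p4:
  fixes x0 :: ereal and T :: real
    and phi1 phi2 dphi1 dphi2 f :: "real \<Rightarrow> real"
  defines "I \<equiv> half_open T x0"
    and "F \<equiv> lim_filter x0"
    and "W \<equiv> Wr phi1 dphi1 phi2 dphi2"
    and "f1s \<equiv> (\<lambda>t. Wr f (deriv f) phi2 dphi2 t / Wr phi1 dphi1 phi2 dphi2 t)"
    and "f2s \<equiv> (\<lambda>t. - Wr f (deriv f) phi1 dphi1 t / Wr phi1 dphi1 phi2 dphi2 t)"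
    and "Phi \<equiv> (\<lambda>x. phi2 T * phi1 x - phi1 T * phi2 x)"
    and "Fs \<equiv> (\<lambda>t. phi1 T * (Wr f (deriv f) phi2 dphi2 t / Wr phi1 dphi1 phi2 dphi2 t)
                     + phi2 T * (- Wr f (deriv f) phi1 dphi1 t / Wr phi1 dphi1 phi2 dphi2 t))"
  assumes Tx0: "ereal T < x0"
    and d1: "\<And>x. x \<in> I \<Longrightarrow> (phi1 has_real_derivative dphi1 x) (at x within I)"
    and d2: "\<And>x. x \<in> I \<Longrightarrow> (phi2 has_real_derivative dphi2 x) (at x within I)"
    and c1: "continuous_on I dphi1"
    and c2: "continuous_on I dphi2"
    and small: "phi2 \<in> o[F](phi1)"
    and nz1: "\<And>x. x \<in> I \<Longrightarrow> phi1 x \<noteq> 0"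
    and nz2: "\<And>x. x \<in> I \<Longrightarrow> phi2 x \<noteq> 0"
    and nzW: "\<And>x. x \<in> I \<Longrightarrow> W x \<noteq> 0"
    and fAC: "AC_on T x0 f"
  shows
    "((\<exists>a1 a2. (\<lambda>x. f x - a1 * phi1 x - a2 * phi2 x) \<in> o[F](phi2))
      \<longleftrightarrow> ((\<forall>x\<in>I. improper_conv (\<lambda>t. W t / (phi1 t)^2 * f2s t) x x0) \<and>
           (\<exists>L. ((\<lambda>x. phi1 x / phi2 x * improper_int (\<lambda>t. W t / (phi1 t)^2 * f2s t) x x0)
                  \<longlongrightarrow> L) F)))
     \<and>
     ((\<exists>a1 a2. (\<lambda>x. f x - a1 * phi1 x - a2 * phi2 x) \<in> o[F](phi2))
      \<longleftrightarrow> ((\<forall>x. T < x \<and> ereal x < x0 \<longrightarrow> improper_conv (\<lambda>t. W t / (Phi t)^2 * Fs t) x x0) \<and>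
           (\<exists>L. ((\<lambda>x. Phi x / phi2 x * improper_int (\<lambda>t. W t / (Phi t)^2 * Fs t) x x0)
                  \<longlongrightarrow> L) F)))
     \<and>
     (\<forall>a1 a2 m. (\<lambda>x. f x - a1 * phi1 x - a2 * phi2 x) \<in> o[F](phi2) \<and>
         ((\<lambda>x. phi1 x / phi2 x * improper_int (\<lambda>t. W t / (phi1 t)^2 * f2s t) x x0)
            \<longlongrightarrow> - m) F
       \<longrightarrow> (\<forall>x\<in>I. improper_conv (\<lambda>t. W t / (phi1 t)^2 * (f2s t - m)) x x0 \<and>
              f x = a1 * phi1 x + a2 * phi2 x
                    - phi1 x * improper_int (\<lambda>t. W t / (phi1 t)^2 * (f2s t - m)) x x0))
     \<and>
     (\<forall>a1 a2 l. (\<lambda>x. f x - a1 * phi1 x - a2 * phi2 x) \<in> o[F](phi2) \<and>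
         ((\<lambda>x. Phi x / phi2 x * improper_int (\<lambda>t. W t / (Phi t)^2 * Fs t) x x0)
            \<longlongrightarrow> - l / phi2 T) F
       \<longrightarrow> (\<forall>x. T < x \<and> ereal x < x0 \<longrightarrow>
              improper_conv (\<lambda>t. W t / (Phi t)^2 * (Fs t - l)) x x0 \<and>
              f x = a1 * phi1 x + a2 * phi2 x
                    - Phi x * improper_int (\<lambda>t. W t / (Phi t)^2 * (Fs t - l)) x x0))"
proof -
  have TI: "T \<in> I" using Tx0 by (simp add: I_def half_open_def)
  have Jx0: "ereal x < x0" if "x \<in> I" for x using that by (simp add: I_def half_open_def)
  have Jup: "y \<in> I" if "x \<in> I" "x \<le> y" "ereal y < x0" for x y
    using that by (auto simp: I_def half_open_def)
  have fac: "abs_cont_on_interval a b f" if "a \<in> I" "a \<le> b" "ereal b < x0" for a b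
    using fAC that by (auto simp: AC_on_def I_def half_open_def)
  interpret phi1: asymptotic_pair x0 I phi1 dphi1 phi2 dphi2 f
    by unfold_locales
      (use TI Jx0 Jup d1 d2 c1 small [unfolded F_def] nz1 nz2 nzW [unfolded W_def] fac in blast)+
  have f2s: "- Wr f (deriv f) phi1 dphi1 t / W t = f2s t" for t
    by (simp add: f2s_def W_def)
  note exp1 = phi1.two_term_expansion [folded F_def W_def, unfolded f2s]

  define p1 p2 where "p1 = phi1 T" and "p2 = phi2 T"
  have "p2 \<noteq> 0" using nz2 [OF TI] by (simp add: p2_def)
  have Phi_eq: "Phi x = p2 * phi1 x - p1 * phi2 x" for x by (simp add: Phi_def p1_def p2_def)
  define dPhi where "dPhi x = p2 * dphi1 x - p1 * dphi2 x" for x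
  define J where "J = {x. T < x \<and> ereal x < x0}"
  have JI: "J \<subseteq> I" by (auto simp: J_def I_def half_open_def)
  \<comment> \<open>The \<open>phi2\<close> component of \<open>Phi\<close> drops out of the
    Wronskian with \<open>phi2\<close>, leaving only the factor \<open>p2\<close>.\<close>
  have W2: "Wr Phi dPhi phi2 dphi2 = (\<lambda>t. p2 * W t)"
    by (auto simp: Wr_def Phi_eq dPhi_def W_def algebra_simps)
  \<comment> \<open>The second coefficient function of \<open>f\<close> for the new pair. It equals
    \<open>Fs / p2\<close>, while the Wronskian carries the factor \<open>p2\<close>; hence the
    kernel is unchanged and the constant to subtract from \<open>fs\<close> is
    \<open>l / p2\<close>. This is why (iii) normalizes its limit as
    \<open>- l / phi2 T\<close>.\<close>
  define fs where "fs t = - Wr f (deriv f) Phi dPhi t / Wr Phi dPhi phi2 dphi2 t" for t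
  have fs_eq: "fs t = Fs t / p2" for t
  proof -
    have "- Wr f (deriv f) Phi dPhi t = p1 * Wr f (deriv f) phi2 dphi2 t + p2 * (- Wr f (deriv f) phi1 dphi1 t)"
      by (simp add: Wr_def Phi_eq dPhi_def algebra_simps)
    then show ?thesis
      unfolding fs_def W2 Fs_def W_def p1_def [symmetric] p2_def [symmetric]
      by (simp add: diff_divide_distrib mult.commute)
  qed
  have kernel: "p2 * W t / (Phi t)\<^sup>2 * (fs t - l / p2) = W t / (Phi t)\<^sup>2 * (Fs t - l)" for t l
    using \<open>p2 \<noteq> 0\<close> by (simp add: fs_eq diff_divide_distrib [symmetric])
  have kernel0: "p2 * W t / (Phi t)\<^sup>2 * fs t = W t / (Phi t)\<^sup>2 * Fs t" for t
    using kernel [of t 0] by simp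
  \<comment> \<open>A zero of \<open>Phi\<close> at \<open>x > T\<close> says that
    \<open>phi2 / phi1\<close> takes the same value at \<open>x\<close> and at \<open>T\<close>.
    Rolle's theorem then gives a zero of its derivative \<open>W / phi1^2\<close>, which does not
    exist.\<close>
  have Phi0: "Phi x \<noteq> 0" if "x \<in> J" for x
  proof
    assume "Phi x = 0"
    have "x \<in> I" "T < x" using that JI by (auto simp: J_def)
    define r where "r t = phi2 t / phi1 t" for t
    have sub: "{T..x} \<subseteq> I"
    proof
      fix t assume t: "t \<in> {T..x}"
      then have "ereal t < x0" using Jx0 [OF \<open>x \<in> I\<close>] by (intro le_less_trans [of "ereal t" "ereal x"]) auto
      then show "t \<in> I" using Jup [OF TI] t by simp
    qed
    have dr: "(r has_real_derivative W t / (phi1 t)\<^sup>2) (at t within {T..x})" if "t \<in> {T..x}" for t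
    proof -
      have "t \<in> I" using sub that by blast
      have "(r has_real_derivative (dphi2 t * phi1 t - phi2 t * dphi1 t) / (phi1 t * phi1 t)) (at t within {T..x})"
        unfolding r_def using d1 [OF \<open>t \<in> I\<close>] d2 [OF \<open>t \<in> I\<close>] sub nz1 [OF \<open>t \<in> I\<close>]
        by (intro DERIV_divide) (auto intro: DERIV_subset)
      then show ?thesis by (simp add: W_def Wr_def power2_eq_square algebra_simps)
    qed
    have dr': "(r has_real_derivative W t / (phi1 t)\<^sup>2) (at t)" if "T < t" "t < x" for t
      using dr [of t] that by (simp add: at_within_Icc_at)
    have "r x = r T"
      using \<open>Phi x = 0\<close> nz1 [OF \<open>x \<in> I\<close>] nz1 [OF TI] by (simp add: r_def Phi_def field_simps)
    then obtain z where z: "T < z" "z < x" "(r has_real_derivative 0) (at z)"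
    proof -
      have "continuous_on {T..x} r"
        using dr by (meson DERIV_continuous continuous_on_eq_continuous_within)
      then have "\<exists>z. T < z \<and> z < x \<and> (r has_real_derivative 0) (at z)"
        using Rolle [OF \<open>T < x\<close> \<open>r x = r T\<close> [symmetric]] dr' real_differentiable_def by blast
      then show thesis using that by blast
    qed
    then have "W z / (phi1 z)\<^sup>2 = 0" using dr' [OF z(1,2)] DERIV_unique by blast
    moreover have "z \<in> I" using sub z by auto
    ultimately show False using nzW nz1 by simp
  qed
  have evJ: "eventually (\<lambda>x. x \<in> J) F"
    unfolding F_def J_def using eventually_lim_filter [OF Tx0] by simp
  \<comment> \<open>Dividing numerator and denominator of \<open>phi2 / Phi\<close> by
    \<open>phi1\<close> expresses it through \<open>phi2 / phi1\<close>, which tends to 0; the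
    denominator tends to \<open>p2\<close>, which is nonzero.\<close>
  have lim0: "((\<lambda>x. (phi2 x / phi1 x) / (p2 - p1 * (phi2 x / phi1 x))) \<longlongrightarrow> 0 / (p2 - p1 * 0)) F"
    using \<open>p2 \<noteq> 0\<close> smalloD_tendsto [OF small] by (intro tendsto_intros) auto
  have ev0: "eventually (\<lambda>x. (phi2 x / phi1 x) / (p2 - p1 * (phi2 x / phi1 x)) = phi2 x / Phi x) F"
    using evJ
  proof eventually_elim
    case (elim x)
    then have "phi1 x \<noteq> 0" using nz1 JI by blast
    moreover have "Phi x = phi1 x * (p2 - p1 * (phi2 x / phi1 x))"
      using \<open>phi1 x \<noteq> 0\<close> by (simp add: Phi_eq field_simps)
    ultimately show ?case by simp
  qed
  have "((\<lambda>x. phi2 x / Phi x) \<longlongrightarrow> 0) F"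
    using Lim_transform_eventually [OF lim0 ev0] by simp
  then have small2: "phi2 \<in> o[F](Phi)"
    using evJ by (intro smalloI_tendsto) (auto elim: eventually_mono dest: Phi0)
  obtain S where "T < S" "ereal S < x0" using ereal_dense2 [OF Tx0] by auto
  then have "J \<noteq> {}" by (auto simp: J_def)
  have exp2: "(\<exists>b1 b2. (\<lambda>x. f x - b1 * Phi x - b2 * phi2 x) \<in> o[F](phi2)) \<longleftrightarrow>
      (\<forall>x\<in>J. improper_conv (\<lambda>t. W t / (Phi t)\<^sup>2 * Fs t) x x0) \<and>
      (\<exists>L. ((\<lambda>x. Phi x / phi2 x * improper_int (\<lambda>t. W t / (Phi t)\<^sup>2 * Fs t) x x0) \<longlongrightarrow> L) F)"
    and exp2': "\<lbrakk>(\<lambda>x. f x - b1 * Phi x - b2 * phi2 x) \<in> o[F](phi2);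
        ((\<lambda>x. Phi x / phi2 x * improper_int (\<lambda>t. W t / (Phi t)\<^sup>2 * Fs t) x x0) \<longlongrightarrow> - (l / p2)) F; x \<in> J\<rbrakk>
      \<Longrightarrow> improper_conv (\<lambda>t. W t / (Phi t)\<^sup>2 * (Fs t - l)) x x0 \<and>
          f x = b1 * Phi x + b2 * phi2 x - Phi x * improper_int (\<lambda>t. W t / (Phi t)\<^sup>2 * (Fs t - l)) x x0"
    for b1 b2 l x
  proof -
    interpret Phi: asymptotic_pair x0 J Phi dPhi phi2 dphi2 f
    proof unfold_locales
      show "(phi2 has_real_derivative dphi2 x) (at x within J)" if "x \<in> J" for x
        using DERIV_subset [OF d2 JI] JI that by blast
      have "(phi1 has_real_derivative dphi1 x) (at x within J)" if "x \<in> J" for x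
        using DERIV_subset [OF d1 JI] JI that by blast
      then show "(Phi has_real_derivative dPhi x) (at x within J)" if "x \<in> J" for x
        unfolding Phi_eq dPhi_def using that
        by (intro DERIV_diff DERIV_cmult) (use DERIV_subset [OF d2 JI] JI in blast)+
      show "continuous_on J dPhi"
        unfolding dPhi_def using c1 c2 JI by (intro continuous_intros) (auto intro: continuous_on_subset)
      show "Wr Phi dPhi phi2 dphi2 x \<noteq> 0" if "x \<in> J" for x
        using nzW \<open>p2 \<noteq> 0\<close> JI that by (auto simp: W2)
      show "phi2 \<in> o[lim_filter x0](Phi)" using small2 by (simp add: F_def)
      show "y \<in> J" if "x \<in> J" "x \<le> y" "ereal y < x0" for x y using that by (auto simp: J_def)
    qed (use \<open>J \<noteq> {}\<close> Phi0 nz2 fac JI in \<open>auto simp: J_def\<close>)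
    note exp = Phi.two_term_expansion [folded F_def fs_def, unfolded W2 kernel0]
    show "(\<exists>b1 b2. (\<lambda>x. f x - b1 * Phi x - b2 * phi2 x) \<in> o[F](phi2)) \<longleftrightarrow>
      (\<forall>x\<in>J. improper_conv (\<lambda>t. W t / (Phi t)\<^sup>2 * Fs t) x x0) \<and>
      (\<exists>L. ((\<lambda>x. Phi x / phi2 x * improper_int (\<lambda>t. W t / (Phi t)\<^sup>2 * Fs t) x x0) \<longlongrightarrow> L) F)"
      using exp(1) .
    show "improper_conv (\<lambda>t. W t / (Phi t)\<^sup>2 * (Fs t - l)) x x0 \<and>
          f x = b1 * Phi x + b2 * phi2 x - Phi x * improper_int (\<lambda>t. W t / (Phi t)\<^sup>2 * (Fs t - l)) x x0"
      if "(\<lambda>x. f x - b1 * Phi x - b2 * phi2 x) \<in> o[F](phi2)"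
        "((\<lambda>x. Phi x / phi2 x * improper_int (\<lambda>t. W t / (Phi t)\<^sup>2 * Fs t) x x0) \<longlongrightarrow> - (l / p2)) F" "x \<in> J"
      for b1 b2 l x
      using exp(2) [OF that, unfolded kernel] .
  qed
  \<comment> \<open>Change of basis between (\<open>phi1\<close>, \<open>phi2\<close>) and
    (\<open>Phi\<close>, \<open>phi2\<close>), possible because \<open>p2\<close> is nonzero. The
    leading combinations are the same function, so the second formula can be stated with the
    original \<open>a1\<close> and \<open>a2\<close>.\<close>
  have base: "f x - a1 * phi1 x - a2 * phi2 x = f x - (a1 / p2) * Phi x - (a2 + a1 * p1 / p2) * phi2 x" for a1 a2 x
    using \<open>p2 \<noteq> 0\<close> by (simp add: Phi_eq field_simps)
  have base': "f x - b1 * Phi x - b2 * phi2 x = f x - (b1 * p2) * phi1 x - (b2 - b1 * p1) * phi2 x" for b1 b2 x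
    by (simp add: Phi_eq algebra_simps)
  have same: "(\<exists>a1 a2. (\<lambda>x. f x - a1 * phi1 x - a2 * phi2 x) \<in> o[F](phi2))
      \<longleftrightarrow> (\<exists>b1 b2. (\<lambda>x. f x - b1 * Phi x - b2 * phi2 x) \<in> o[F](phi2))"
  proof
    assume "\<exists>a1 a2. (\<lambda>x. f x - a1 * phi1 x - a2 * phi2 x) \<in> o[F](phi2)"
    then show "\<exists>b1 b2. (\<lambda>x. f x - b1 * Phi x - b2 * phi2 x) \<in> o[F](phi2)"
      unfolding base by blast
  next
    assume "\<exists>b1 b2. (\<lambda>x. f x - b1 * Phi x - b2 * phi2 x) \<in> o[F](phi2)"
    then show "\<exists>a1 a2. (\<lambda>x. f x - a1 * phi1 x - a2 * phi2 x) \<in> o[F](phi2)"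
      unfolding base' by blast
  qed
  show ?thesis
  proof (intro conjI allI impI ballI; (elim conjE)?)
    show "(\<exists>a1 a2. (\<lambda>x. f x - a1 * phi1 x - a2 * phi2 x) \<in> o[F](phi2)) \<longleftrightarrow>
        (\<forall>x\<in>I. improper_conv (\<lambda>t. W t / (phi1 t)\<^sup>2 * f2s t) x x0) \<and>
        (\<exists>L. ((\<lambda>x. phi1 x / phi2 x * improper_int (\<lambda>t. W t / (phi1 t)\<^sup>2 * f2s t) x x0) \<longlongrightarrow> L) F)"
      using exp1(1) .
    show "(\<exists>a1 a2. (\<lambda>x. f x - a1 * phi1 x - a2 * phi2 x) \<in> o[F](phi2)) \<longleftrightarrow>
        (\<forall>x. T < x \<and> ereal x < x0 \<longrightarrow> improper_conv (\<lambda>t. W t / (Phi t)\<^sup>2 * Fs t) x x0) \<and>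
        (\<exists>L. ((\<lambda>x. Phi x / phi2 x * improper_int (\<lambda>t. W t / (Phi t)\<^sup>2 * Fs t) x x0) \<longlongrightarrow> L) F)"
      using exp2 unfolding same J_def by simp
  next
    fix a1 a2 m x
    assume "(\<lambda>x. f x - a1 * phi1 x - a2 * phi2 x) \<in> o[F](phi2)"
      "((\<lambda>x. phi1 x / phi2 x * improper_int (\<lambda>t. W t / (phi1 t)\<^sup>2 * f2s t) x x0) \<longlongrightarrow> - m) F" "x \<in> I"
    note form = exp1(2) [OF this]
    show "improper_conv (\<lambda>t. W t / (phi1 t)\<^sup>2 * (f2s t - m)) x x0"
      "f x = a1 * phi1 x + a2 * phi2 x - phi1 x * improper_int (\<lambda>t. W t / (phi1 t)\<^sup>2 * (f2s t - m)) x x0"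
      using form by blast+
  next
    fix a1 a2 l x
    assume exp: "(\<lambda>x. f x - a1 * phi1 x - a2 * phi2 x) \<in> o[F](phi2)"
      and lim: "((\<lambda>x. Phi x / phi2 x * improper_int (\<lambda>t. W t / (Phi t)\<^sup>2 * Fs t) x x0) \<longlongrightarrow> - l / phi2 T) F"
      and x: "T < x" "ereal x < x0"
    have "x \<in> J" using x by (simp add: J_def)
    have lim': "((\<lambda>x. Phi x / phi2 x * improper_int (\<lambda>t. W t / (Phi t)\<^sup>2 * Fs t) x x0) \<longlongrightarrow> - (l / p2)) F"
      using lim by (simp add: p2_def)
    note form = exp2' [OF exp [unfolded base] lim' \<open>x \<in> J\<close>]
    show "improper_conv (\<lambda>t. W t / (Phi t)\<^sup>2 * (Fs t - l)) x x0" using form by blast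
    show "f x = a1 * phi1 x + a2 * phi2 x - Phi x * improper_int (\<lambda>t. W t / (Phi t)\<^sup>2 * (Fs t - l)) x x0"
      using form base [of x a1 a2] by linarith
  qed
qed

end
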